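(* Let $n\in\mathbb{N}$, let $A=\{1<2<\cdots<n\}$, and let $L\subseteq A^*$ be the language $$L=\bigl\{\alpha^{(1)}\alpha^{(2)}\cdots\alpha^{(k)} : k\in\mathbb{N}\cup\{0\},\ \text{each } \alpha^{(i)} \text{ is a non-empty column},\ \alpha^{(j)}\succeq\alpha^{(j+1)}\text{ for all } 1\le j<k\bigr\}.$$ Then $(A,L)$ is a biautomatic structure for the Plactic monoid $M_n$.
   Context: Let $n \in \mathbb{N}=\{1,2,\ldots\}$ and $A = \{1<2<\cdots<n\}$. The Plactic monoid $M_n$ is the monoid presented by $\langle A \mid \mathcal{R}\rangle$, where $\mathcal{R} = \{(xzy,zxy) : x \le y < z\} \cup \{(yxz,yzx) : x<y\le z\}$ with $x,y,z\in A$. A column is a strictly decreasing word $\alpha=\alpha_k\cdots\alpha_1\in A^*$ ($\alpha_{i+1}>\alpha_i$ for all $i$). For columns $\alpha=\alpha_k\cdots\alpha_1$ and $\beta=\beta_l\cdots\beta_1$, write $\alpha\succeq\beta$ if $k\ge l$ and $\alpha_i\le\beta_i$ for all $i\le l$. Padding maps: for an alphabet $X$ and a symbol $\$\notin X$, define $\delta_{\mathrm R},\delta_{\mathrm L}:X^*\times X^*\to((X\cup\{\$\})\times(X\cup\{\$\}))^*$ as follows. For words $u,v$, $(u,v)\delta_{\mathrm R}$ is obtained by appending copies of $\$$ at the right-hand end of the shorter of $u,v$ until both have equal length and then reading the two words as a single word of pairs of symbols; $(u,v)\delta_{\mathrm L}$ is defined in the same way but with the copies of $\$$ added at the left-hand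 end of the shorter word. For a relation $S\subseteq X^*\times X^*$, $S\delta_{\mathrm R}$ and $S\delta_{\mathrm L}$ denote the images of $S$. Biautomatic structure: let $M$ be a monoid, $X$ a finite alphabet representing a set of generators for $M$, and $L\subseteq X^*$ a regular language such that every element of $M$ has at least one representative in $L$. Let $\varepsilon$ be the empty word. For $a\in X\cup\{\varepsilon\}$ let $L_a=\{(u,v):u,v\in L,\ ua=_Mv\}$ and ${}_aL=\{(u,v):u,v\in L,\ au=_Mv\}$, where $=_M$ means representing the same element of $M$. The pair $(X,L)$ is a biautomatic structure for $M$ if $L_a\delta_{\mathrm R}$, ${}_aL\delta_{\mathrm R}$, $L_a\delta_{\mathrm L}$ and ${}_aL\delta_{\mathrm L}$ are regular languages over $(X\cup\{\$\})\times(X\cup\{\$\})$ for all $a\in X\cup\{\varepsilon\}$. *)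

theory Defs
  imports "HOL-Algebra.Group"
begin

section \<open>Regular languages\<close>

text \<open>Recognition by a complete deterministic automaton over the finite alphabet \<open>\<Sigma>\<close>. States are
  natural numbers, which is no restriction for finite automata: see \<open>regular_languageI\<close>.\<close>

definition regular_language :: "'a set \<Rightarrow> 'a list set \<Rightarrow> bool" where
  "regular_language \<Sigma> K \<longleftrightarrow> finite \<Sigma> \<and>
     (\<exists>(Q :: nat set) q\<^sub>0 F \<delta>. finite Q \<and> q\<^sub>0 \<in> Q \<and> F \<subseteq> Q \<and> (\<forall>q\<in>Q. \<forall>a\<in>\<Sigma>. \<delta> q a \<in> Q) \<and>
        K = {w \<in> lists \<Sigma>. foldl \<delta> q\<^sub>0 w \<in> F})"

lemma regular_languageI:
  fixes Q :: "'s set"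
  assumes "finite \<Sigma>" "finite Q" "q\<^sub>0 \<in> Q" "F \<subseteq> Q" and \<delta>: "\<And>q a. q \<in> Q \<Longrightarrow> a \<in> \<Sigma> \<Longrightarrow> \<delta> q a \<in> Q"
    and K: "K = {w \<in> lists \<Sigma>. foldl \<delta> q\<^sub>0 w \<in> F}"
  shows "regular_language \<Sigma> K"
proof -
  obtain f :: "'s \<Rightarrow> nat" where f: "inj_on f Q"
    using finite_imp_inj_to_nat_seg[OF \<open>finite Q\<close>] by blast
  define g where "g = inv_into Q f"
  have gf: "g (f q) = q" if "q \<in> Q" for q
    using f that by (simp add: g_def)
  define \<delta>' where "\<delta>' = (\<lambda>q a. f (\<delta> (g q) a))"
  have run: "foldl \<delta>' (f q) w = f (foldl \<delta> q w) \<and> foldl \<delta> q w \<in> Q" if "w \<in> lists \<Sigma>" "q \<in> Q" for w q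
    using that by (induction w arbitrary: q) (auto simp: \<delta>'_def gf \<delta>)
  have "K = {w \<in> lists \<Sigma>. foldl \<delta>' (f q\<^sub>0) w \<in> f ` F}"
    using run \<open>q\<^sub>0 \<in> Q\<close> \<open>F \<subseteq> Q\<close> inj_on_image_mem_iff[OF f] unfolding K
    by (intro Collect_cong conj_cong refl) metis
  moreover have "\<forall>q\<in>f ` Q. \<forall>a\<in>\<Sigma>. \<delta>' q a \<in> f ` Q"
    by (auto simp: \<delta>'_def gf \<delta>)
  ultimately show ?thesis
    unfolding regular_language_def using assms(1-4)
    by (intro conjI exI[of _ "f ` Q"] exI[of _ "f q\<^sub>0"] exI[of _ "f ` F"] exI[of _ \<delta>']) auto
qed


section \<open>Biautomatic structures\<close>

text \<open>The padding symbol is \<^term>\<open>None\<close>; a letter \<open>a\<close> becomes \<^term>\<open>Some a\<close>.\<close>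

definition pad_right :: "nat \<Rightarrow> 'a list \<Rightarrow> 'a option list" where
  "pad_right m w = map Some w @ replicate (m - length w) None"

definition pad_left :: "nat \<Rightarrow> 'a list \<Rightarrow> 'a option list" where
  "pad_left m w = replicate (m - length w) None @ map Some w"

definition delta_R :: "'a list \<times> 'a list \<Rightarrow> ('a option \<times> 'a option) list" where
  "delta_R = (\<lambda>(u, v). let m = max (length u) (length v) in zip (pad_right m u) (pad_right m v))"

definition delta_L :: "'a list \<times> 'a list \<Rightarrow> ('a option \<times> 'a option) list" where
  "delta_L = (\<lambda>(u, v). let m = max (length u) (length v) in zip (pad_left m u) (pad_left m v))"

definition padded_alphabet :: "'a set \<Rightarrow> ('a option \<times> 'a option) set" where
  "padded_alphabet X = insert None (Some ` X) \<times> insert None (Some ` X)"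

definition word_value :: "('m, 'b) monoid_scheme \<Rightarrow> ('a \<Rightarrow> 'm) \<Rightarrow> 'a list \<Rightarrow> 'm" where
  "word_value M \<phi> w = foldr (\<lambda>a m. \<phi> a \<otimes>\<^bsub>M\<^esub> m) w \<one>\<^bsub>M\<^esub>"

text \<open>The relations \<open>L\<^sub>a\<close> and \<open>\<^sub>aL\<close>. Their index is the word \<open>a\<close>, a single letter or empty.\<close>

definition right_rel ::
  "('m, 'b) monoid_scheme \<Rightarrow> ('a \<Rightarrow> 'm) \<Rightarrow> 'a list set \<Rightarrow> 'a list \<Rightarrow> ('a list \<times> 'a list) set" where
  "right_rel M \<phi> L a = {(u, v). u \<in> L \<and> v \<in> L \<and> word_value M \<phi> (u @ a) = word_value M \<phi> v}"

definition left_rel ::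
  "('m, 'b) monoid_scheme \<Rightarrow> ('a \<Rightarrow> 'm) \<Rightarrow> 'a list set \<Rightarrow> 'a list \<Rightarrow> ('a list \<times> 'a list) set" where
  "left_rel M \<phi> L a = {(u, v). u \<in> L \<and> v \<in> L \<and> word_value M \<phi> (a @ u) = word_value M \<phi> v}"

text \<open>The alphabet \<open>X\<close> represents generators of \<open>M\<close> through the map \<open>\<phi>\<close>.\<close>

definition biautomatic_structure ::
  "('m, 'b) monoid_scheme \<Rightarrow> ('a \<Rightarrow> 'm) \<Rightarrow> 'a set \<Rightarrow> 'a list set \<Rightarrow> bool" where
  "biautomatic_structure M \<phi> X L \<longleftrightarrow>
     monoid M \<and> finite X \<and> \<phi> ` X \<subseteq> carrier M \<and> word_value M \<phi> ` lists X = carrier M \<and>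
     L \<subseteq> lists X \<and> regular_language X L \<and>
     (\<forall>m\<in>carrier M. \<exists>w\<in>L. word_value M \<phi> w = m) \<and>
     (\<forall>a\<in>insert [] ((\<lambda>x. [x]) ` X).
        regular_language (padded_alphabet X) (delta_R ` right_rel M \<phi> L a) \<and>
        regular_language (padded_alphabet X) (delta_R ` left_rel M \<phi> L a) \<and>
        regular_language (padded_alphabet X) (delta_L ` right_rel M \<phi> L a) \<and>
        regular_language (padded_alphabet X) (delta_L ` left_rel M \<phi> L a))"


section \<open>Monoid presentations\<close>

text \<open>The least congruence on the free monoid \<^term>\<open>lists X\<close> containing the defining relations
  \<open>R\<close>, which are supposed to be pairs of words over \<open>X\<close>.\<close>

inductive_set presented_cong :: "'a set \<Rightarrow> ('a list \<times> 'a list) set \<Rightarrow> ('a list \<times> 'a list) set"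
  for X R where
  rel: "(u, v) \<in> R \<Longrightarrow> (u, v) \<in> presented_cong X R"
| refl: "u \<in> lists X \<Longrightarrow> (u, u) \<in> presented_cong X R"
| sym: "(u, v) \<in> presented_cong X R \<Longrightarrow> (v, u) \<in> presented_cong X R"
| trans: "(u, v) \<in> presented_cong X R \<Longrightarrow> (v, w) \<in> presented_cong X R \<Longrightarrow> (u, w) \<in> presented_cong X R"
| append: "(u, v) \<in> presented_cong X R \<Longrightarrow> (s, t) \<in> presented_cong X R \<Longrightarrow>
    (u @ s, v @ t) \<in> presented_cong X R"

definition presented_class :: "'a set \<Rightarrow> ('a list \<times> 'a list) set \<Rightarrow> 'a list \<Rightarrow> 'a list set" where
  "presented_class X R w = presented_cong X R `` {w}"

definition presented_monoid :: "'a set \<Rightarrow> ('a list \<times> 'a list) set \<Rightarrow> 'a list set monoid" where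
  "presented_monoid X R =
     \<lparr>carrier = lists X // presented_cong X R,
      mult = (\<lambda>P Q. \<Union>u\<in>P. \<Union>v\<in>Q. presented_class X R (u @ v)),
      one = presented_class X R []\<rparr>"

lemma presented_cong_equiv:
  assumes "R \<subseteq> lists X \<times> lists X"
  shows "equiv (lists X) (presented_cong X R)"
proof (rule equivI)
  have "u \<in> lists X \<and> v \<in> lists X" if "(u, v) \<in> presented_cong X R" for u v
    using that by induction (use assms in auto)
  then show "presented_cong X R \<subseteq> lists X \<times> lists X" by auto
  show "refl_on (lists X) (presented_cong X R)"
    by (auto simp: refl_on_def intro: presented_cong.refl)
  show "sym_on UNIV (presented_cong X R)" by (auto intro: symI presented_cong.sym)
  show "trans_on UNIV (presented_cong X R)" by (auto intro: transI presented_cong.trans)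
qed

lemma presented_class_eq_iff:
  assumes "R \<subseteq> lists X \<times> lists X" "u \<in> lists X" "v \<in> lists X"
  shows "presented_class X R u = presented_class X R v \<longleftrightarrow> (u, v) \<in> presented_cong X R"
  unfolding presented_class_def using eq_equiv_class_iff[OF presented_cong_equiv] assms by blast

lemma presented_class_mult:
  assumes R: "R \<subseteq> lists X \<times> lists X" and "u \<in> lists X" "v \<in> lists X"
  shows "presented_class X R u \<otimes>\<^bsub>presented_monoid X R\<^esub> presented_class X R v = presented_class X R (u @ v)"
proof -
  have "presented_class X R (s @ t) = presented_class X R (u @ v)"
    if "s \<in> presented_class X R u" "t \<in> presented_class X R v" for s t
    using that equiv_class_eq[OF presented_cong_equiv[OF R]]
    by (metis Image_singleton_iff presented_class_def presented_cong.append)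
  moreover have "u \<in> presented_class X R u" "v \<in> presented_class X R v"
    using assms(2,3) by (auto simp: presented_class_def intro: presented_cong.refl)
  ultimately show ?thesis
    unfolding presented_monoid_def monoid.simps by blast
qed

lemma presented_monoid_carrier:
  "carrier (presented_monoid X R) = presented_class X R ` lists X"
  by (auto simp: presented_monoid_def presented_class_def quotient_def)

lemma presented_monoid_monoid:
  assumes "R \<subseteq> lists X \<times> lists X"
  shows "monoid (presented_monoid X R)"
proof -
  note mult = presented_class_mult[OF assms, unfolded in_lists_conv_set]
  have one: "\<one>\<^bsub>presented_monoid X R\<^esub> = presented_class X R []"
    by (simp add: presented_monoid_def)
  show ?thesis
  proof (rule monoidI, unfold presented_monoid_carrier one)
    show "presented_class X R [] \<in> presented_class X R ` lists X"
      by (rule imageI) simp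
  qed (auto simp: mult ball_Un intro!: imageI)
qed

lemma presented_monoid_word_value:
  assumes "R \<subseteq> lists X \<times> lists X" "w \<in> lists X"
  shows "word_value (presented_monoid X R) (\<lambda>a. presented_class X R [a]) w = presented_class X R w"
  using assms(2)
proof (induction w)
  case Nil
  show ?case by (simp add: word_value_def presented_monoid_def)
next
  case (Cons a w)
  then show ?case
    using presented_class_mult[OF assms(1), of "[a]" w] by (simp add: word_value_def)
qed


section \<open>The Plactic monoid\<close>

definition plactic_rels :: "nat \<Rightarrow> (nat list \<times> nat list) set" where
  "plactic_rels n =
     {([x, z, y], [z, x, y]) | x y z. {x, y, z} \<subseteq> {1..n} \<and> x \<le> y \<and> y < z} \<union>
     {([y, x, z], [y, z, x]) | x y z. {x, y, z} \<subseteq> {1..n} \<and> x < y \<and> y \<le> z}"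

lemma plactic_rels_subset: "plactic_rels n \<subseteq> lists {1..n} \<times> lists {1..n}"
  by (auto simp: plactic_rels_def)

definition plactic_monoid :: "nat \<Rightarrow> nat list set monoid" where
  "plactic_monoid n = presented_monoid {1..n} (plactic_rels n)"

definition plactic_gen :: "nat \<Rightarrow> nat \<Rightarrow> nat list set" where
  "plactic_gen n a = presented_class {1..n} (plactic_rels n) [a]"

definition column :: "nat \<Rightarrow> nat list \<Rightarrow> bool" where
  "column n \<alpha> \<longleftrightarrow> \<alpha> \<in> lists {1..n} \<and> sorted_wrt (>) \<alpha>"

text \<open>Columns are indexed from the right, \<open>\<alpha> = \<alpha>\<^sub>k \<dots> \<alpha>\<^sub>1\<close>, so that \<open>\<alpha>\<^sub>i = rev \<alpha> ! (i - 1)\<close>.\<close>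

definition column_succeq :: "nat list \<Rightarrow> nat list \<Rightarrow> bool" (infix \<open>\<succeq>\<close> 50) where
  "\<alpha> \<succeq> \<beta> \<longleftrightarrow> length \<beta> \<le> length \<alpha> \<and> (\<forall>i<length \<beta>. rev \<alpha> ! i \<le> rev \<beta> ! i)"

definition plactic_lang :: "nat \<Rightarrow> nat list set" where
  "plactic_lang n =
     {concat \<alpha>s | \<alpha>s. (\<forall>\<alpha>\<in>set \<alpha>s. column n \<alpha> \<and> \<alpha> \<noteq> []) \<and>
        (\<forall>j. Suc j < length \<alpha>s \<longrightarrow> \<alpha>s ! j \<succeq> \<alpha>s ! Suc j)}"

end

theory Submission
  imports Defs
begin

text \<open>Words of the language are column readings of tableaux. Inserting a letter \<open>a\<close> into a column \<open>C\<close>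
  replaces the least letter \<open>e \<ge> a\<close> of \<open>C\<close> by \<open>a\<close> and expels \<open>e\<close> on the right. Passing Knuth-equivalent
  words through a column gives the same column and Knuth-equivalent expelled words, while the word of
  a tableau passes through the empty column by leaving its first column there and expelling the rest;
  hence a tableau word is determined by its class. Left multiplication by a letter sends a letter
  through the columns from left to right, right multiplication sends one from right to left. In both
  cases the columns of the new tableau are related to the old ones by a local rule involving two
  adjacent columns and one letter, so that the pairs of words are read by a finite automaton whose
  transitions carry whole columns; the two tapes stay at bounded distance, which turns it into a
  synchronous automaton, and the direction of propagation is irrelevant by nondeterminism.\<close>

section \<open>Words read by block automata\<close>

text \<open>Every run is framed by two imaginary columns: the full column \<open>{1..n}\<close> on
  the left, which dominates every column, and the empty column on the right, which reads as the
  empty word. The first and the last step are then instances of the same rule as all others.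

  The obstacle is that the new columns must again form a tableau although a transition sees only two
  adjacent old columns. Interlacing makes this local: if \<open>A\<close> and \<open>B\<close> are
  adjacent old columns and \<open>E\<close> is the new column at the place of \<open>B\<close>, then
  \<open>A\<close> dominates \<open>E\<close> and \<open>E\<close> dominates \<open>B\<close>, so
  that consecutive new columns are separated by an old one. Such inequalities are proved by counting
  the letters up to a bound \<open>t\<close>.

  A letter in transit accounts for the difference in length between the two tapes, so the number of
  carried letters, up to sign, is the potential that bounds their distance.\<close>

lemma regular_by_derivatives:
  fixes K :: "'c \<Rightarrow> 'a list set"
  assumes fin: "finite \<Sigma>" "finite C" and c0: "c\<^sub>0 \<in> C"
    and sub: "\<And>c. c \<in> C \<Longrightarrow> K c \<subseteq> lists \<Sigma>"
    and deriv: "\<And>c a s. c \<in> C \<Longrightarrow> a # s \<in> K c \<Longrightarrow>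
      \<exists>c'\<in>C. s \<in> K c' \<and> (\<forall>s'\<in>K c'. a # s' \<in> K c)"
  shows "regular_language \<Sigma> (K c\<^sub>0)"
proof -
  \<comment> \<open>Subset construction: a set of indices stands for the union of its
    \<open>K c\<close>. By \<open>deriv\<close>, the \<open>K c'\<close> collected in
    \<open>\<delta> D a\<close> exhaust the words that remain after \<open>a\<close>.\<close>
  define \<delta> where "\<delta> = (\<lambda>D a. {c' \<in> C. \<exists>c\<in>D. \<forall>s'\<in>K c'. a # s' \<in> K c})"
  define F where "F = {D. D \<subseteq> C \<and> (\<exists>c\<in>D. [] \<in> K c)}"
  have run: "foldl \<delta> D w \<in> F \<longleftrightarrow> (\<exists>c\<in>D. w \<in> K c)" if "D \<subseteq> C" for D w
    using that
  proof (induction w arbitrary: D)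
    case Nil
    then show ?case by (simp add: F_def)
  next
    case (Cons a w)
    have "\<delta> D a \<subseteq> C" by (auto simp: \<delta>_def)
    then have "foldl \<delta> D (a # w) \<in> F \<longleftrightarrow> (\<exists>c'\<in>\<delta> D a. w \<in> K c')"
      using Cons.IH by simp
    also have "\<dots> \<longleftrightarrow> (\<exists>c\<in>D. a # w \<in> K c)"
    proof
      assume "\<exists>c\<in>D. a # w \<in> K c"
      then obtain c where "c \<in> D" "a # w \<in> K c" by blast
      then show "\<exists>c'\<in>\<delta> D a. w \<in> K c'"
        using deriv[of c a w] Cons.prems unfolding \<delta>_def by blast
    qed (auto simp: \<delta>_def)
    finally show ?case .
  qed
  show ?thesis
  proof (rule regular_languageI[where Q = "Pow C" and q\<^sub>0 = "{c\<^sub>0}" and F = F and \<delta> = \<delta>])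
    show "K c\<^sub>0 = {w \<in> lists \<Sigma>. foldl \<delta> {c\<^sub>0} w \<in> F}"
      using run[of "{c\<^sub>0}"] c0 sub by auto
  qed (use fin c0 in \<open>auto simp: F_def \<delta>_def\<close>)
qed

lemma regular_language_vimage:
  assumes "regular_language \<Sigma> K" "finite \<Gamma>" "h ` \<Gamma> \<subseteq> \<Sigma>"
  shows "regular_language \<Gamma> {w \<in> lists \<Gamma>. map h w \<in> K}"
proof -
  obtain Q :: "nat set" and q\<^sub>0 F \<delta> where A: "finite Q" "q\<^sub>0 \<in> Q" "F \<subseteq> Q"
    "\<forall>q\<in>Q. \<forall>a\<in>\<Sigma>. \<delta> q a \<in> Q" "K = {w \<in> lists \<Sigma>. foldl \<delta> q\<^sub>0 w \<in> F}"
    using assms(1) unfolding regular_language_def by blast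
  have "foldl (\<lambda>q a. \<delta> q (h a)) q w = foldl \<delta> q (map h w)" for q w
    by (simp add: foldl_map)
  moreover have "map h w \<in> lists \<Sigma>" if "w \<in> lists \<Gamma>" for w
    using that assms(3) by (auto simp: image_subset_iff)
  ultimately show ?thesis
    using A assms(2,3)
    by (intro regular_languageI[where Q = Q and q\<^sub>0 = q\<^sub>0 and F = F and \<delta> = "\<lambda>q a. \<delta> q (h a)"]) auto
qed

section \<open>Two-tape automata whose transitions read blocks of letters\<close>

lemma zip_in_lists: "x \<in> lists X \<Longrightarrow> y \<in> lists Y \<Longrightarrow> zip x y \<in> lists (X \<times> Y)"
  by (induction x y rule: list_induct2') auto

inductive path :: "('q \<times> 'a list \<times> 'b list \<times> 'q) set \<Rightarrow> 'q \<Rightarrow> 'a list \<Rightarrow> 'b list \<Rightarrow> 'q \<Rightarrow> bool"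
  for T where
  path_refl: "path T q [] [] q"
| path_step: "(q, x, y, q') \<in> T \<Longrightarrow> path T q' u v q'' \<Longrightarrow> path T q (x @ u) (y @ v) q''"

lemma path_trans:
  "path T q x y q' \<Longrightarrow> path T q' u v q'' \<Longrightarrow> path T q (x @ u) (y @ v) q''"
  by (induction rule: path.induct) (auto intro: path.intros)

lemma path_single: "(q, x, y, q') \<in> T \<Longrightarrow> path T q x y q'"
  using path_step[OF _ path_refl] by fastforce

text \<open>The length differences of the transitions telescope, so the excess of one tape over the
  other depends only on the end states.\<close>

lemma path_length:
  assumes "path T q x y q'"
    and "\<And>q x y q'. (q, x, y, q') \<in> T \<Longrightarrow> int (length x) + f q' = int (length y) + f q"
  shows "int (length x) + f q' = int (length y) + f q"
  using assms(1) by induction (use assms(2) in fastforce)+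

lemma path_lists:
  assumes "path T q x y q'"
    and "\<And>q x y q'. (q, x, y, q') \<in> T \<Longrightarrow> x \<in> lists X \<and> y \<in> lists Y"
  shows "x \<in> lists X \<and> y \<in> lists Y"
  using assms(1) by induction (use assms(2) in fastforce)+

text \<open>The potential \<open>f\<close> keeps the two tapes at bounded distance along every accepting path, so the
  letters by which one tape is ahead can be stored in the state.\<close>

lemma regular_path:
  fixes T :: "('q \<times> 'a list \<times> 'b list \<times> 'q) set" and f :: "'q \<Rightarrow> int"
  assumes fin: "finite X" "finite Y" "finite T"
    and T: "\<And>q x y q'. (q, x, y, q') \<in> T \<Longrightarrow> x \<in> lists X \<and> y \<in> lists Y"
    and f: "\<And>q x y q'. (q, x, y, q') \<in> T \<Longrightarrow> int (length x) + f q' = int (length y) + f q"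
    and ends: "f q\<^sub>0 = f q\<^sub>1"
  shows "regular_language (X \<times> Y) {zip x y | x y. path T q\<^sub>0 x y q\<^sub>1}"
proof -
  define Q where "Q = insert q\<^sub>0 ((\<lambda>(q, x, y, q'). q') ` T)"
  have Q: "finite Q" using fin by (simp add: Q_def)
  \<comment> \<open>If one buffer is empty, the other makes up the difference of the remaining
    lengths, which is \<open>f q - f q\<^sub>1\<close> up to sign and so at most \<open>N\<close> in
    size. Only then is a block, of length at most \<open>M\<close>, appended; hence the bound
    \<open>N + M\<close>.\<close>
  define N where "N = Max ((\<lambda>q. nat \<bar>f q - f q\<^sub>1\<bar>) ` Q)"
  have N: "nat \<bar>f q - f q\<^sub>1\<bar> \<le> N" if "q \<in> Q" for q
    unfolding N_def using Q that by simp
  define M where "M = Max (insert 0 ((\<lambda>(q, x, y, q'). length x + length y) ` T))"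
  have M: "length x + length y \<le> M" if "(q, x, y, q') \<in> T" for q x y q'
    unfolding M_def using that fin by (intro Max_ge) force+
  define C where "C = Q \<times> {r \<in> lists X. length r \<le> N + M} \<times> {t \<in> lists Y. length t \<le> N + M}"
  have C: "finite C"
    using Q fin finite_lists_length_le[of X "N + M"] finite_lists_length_le[of Y "N + M"]
    by (simp add: C_def lists_eq_set conj_commute Int_def)
  \<comment> \<open>\<open>r\<close> and \<open>t\<close> hold letters already read by a transition
    but not yet consumed as pairs.\<close>
  define K where "K = (\<lambda>(q, r, t). {zip (r @ x) (t @ y) | x y.
    path T q x y q\<^sub>1 \<and> length (r @ x) = length (t @ y)})"
  have KI: "zip (r @ x) (t @ y) \<in> K (q, r, t)"
    if "path T q x y q\<^sub>1" "length (r @ x) = length (t @ y)" for q r t x y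
    using that unfolding K_def by blast
  have K_Cons: "(a, b) # s \<in> K (q, a # r, b # t)" if "s \<in> K (q, r, t)" for a b s q r t
  proof -
    obtain x y where "s = zip (r @ x) (t @ y)" "path T q x y q\<^sub>1" "length (r @ x) = length (t @ y)"
      using \<open>s \<in> K (q, r, t)\<close> unfolding K_def by blast
    then show ?thesis using KI[of q x y "a # r" "b # t"] by simp
  qed
  have head: "\<exists>c'\<in>C. s \<in> K c' \<and> (\<forall>s'\<in>K c'. ab # s' \<in> K (q, r, t))"
    if "path T q x y q\<^sub>1" "(q, r, t) \<in> C" "length (r @ x) = length (t @ y)"
      "zip (r @ x) (t @ y) = ab # s" "r \<noteq> []" "t \<noteq> []" for q x y r t s ab
  proof -
    obtain a r' b t' where rt: "r = a # r'" "t = b # t'"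
      using \<open>r \<noteq> []\<close> \<open>t \<noteq> []\<close> by (meson neq_Nil_conv)
    have "(q, r', t') \<in> C" using that(2) rt by (simp add: C_def)
    moreover have "s \<in> K (q, r', t')" using KI[OF that(1), of r' t'] that(3,4) rt by simp
    moreover have "ab = (a, b)" using that(4) rt by simp
    ultimately show ?thesis using K_Cons rt by blast
  qed
  \<comment> \<open>With both buffers nonempty a pair is removed; otherwise the next transition is
    moved into the buffers. Blocks may be empty, so several transitions may be absorbed before a
    pair is read.\<close>
  have deriv: "\<exists>c'\<in>C. s \<in> K c' \<and> (\<forall>s'\<in>K c'. ab # s' \<in> K (q, r, t))"
    if "path T q x y q'" "q' = q\<^sub>1" "(q, r, t) \<in> C" "length (r @ x) = length (t @ y)"
      "zip (r @ x) (t @ y) = ab # s" for q x y q' r t s ab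
    using that
  proof (induction arbitrary: r t)
    case (path_refl q)
    then have "r \<noteq> []" "t \<noteq> []" by auto
    then show ?case using head[of q "[]" "[]" r t ab s] path_refl path.path_refl[of T q] by simp
  next
    case (path_step q x y q' u v q'')
    show ?case
    proof (cases "r = [] \<or> t = []")
      case False
      then show ?thesis
        using head[of q "x @ u" "y @ v" r t ab s] path_step.prems
          path.path_step[OF path_step.hyps(1,2)] by blast
    next
      case True
      have "int (length (x @ u)) + f q\<^sub>1 = int (length (y @ v)) + f q"
        using path_length[OF path.path_step[OF path_step.hyps(1,2), unfolded path_step.prems(1)] f] .
      moreover have "q \<in> Q" using path_step.prems by (simp add: C_def)
      ultimately have "length r \<le> N" "length t \<le> N"
        using True N[of q] path_step.prems(3) by auto
      then have "(q', r @ x, t @ y) \<in> C"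
        using path_step.prems(2) M[OF path_step.hyps(1)] T[OF path_step.hyps(1)]
          rev_image_eqI[OF path_step.hyps(1), of q' "\<lambda>(q, x, y, q'). q'"]
        by (simp add: C_def Q_def)
      then obtain c' where c': "c' \<in> C" "s \<in> K c'" "\<forall>s'\<in>K c'. ab # s' \<in> K (q', r @ x, t @ y)"
        using path_step.IH[of "r @ x" "t @ y"] path_step.prems by auto
      have "K (q', r @ x, t @ y) \<subseteq> K (q, r, t)"
      proof
        fix z assume "z \<in> K (q', r @ x, t @ y)"
        then obtain x' y' where z: "z = zip (r @ x @ x') (t @ y @ y')" "path T q' x' y' q\<^sub>1"
          "length (r @ x @ x') = length (t @ y @ y')" unfolding K_def by auto
        show "z \<in> K (q, r, t)"
          using KI[OF path.path_step[OF path_step.hyps(1) z(2)], of r t] z by simp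
      qed
      with c' show ?thesis by blast
    qed
  qed
  have "K (q\<^sub>0, [], []) = {zip x y | x y. path T q\<^sub>0 x y q\<^sub>1}"
    using path_length[of T q\<^sub>0 _ _ q\<^sub>1 f] f ends by (fastforce simp: K_def)
  moreover have "regular_language (X \<times> Y) (K (q\<^sub>0, [], []))"
  proof (rule regular_by_derivatives[OF _ C])
    show "(q\<^sub>0, [], []) \<in> C" by (simp add: C_def Q_def)
    show "K c \<subseteq> lists (X \<times> Y)" if cC: "c \<in> C" for c
    proof
      fix z assume z: "z \<in> K c"
      obtain q r t where c: "c = (q, r, t)" by (cases c)
      obtain x y where xy: "z = zip (r @ x) (t @ y)" "path T q x y q\<^sub>1" using z c by (auto simp: K_def)
      have "r @ x \<in> lists X" "t @ y \<in> lists Y"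
        using path_lists[OF xy(2) T] cC c by (auto simp: C_def)
      then show "z \<in> lists (X \<times> Y)"
        unfolding xy(1) by (rule zip_in_lists)
    qed
    show "\<exists>c'\<in>C. s \<in> K c' \<and> (\<forall>s'\<in>K c'. a # s' \<in> K c)" if cC: "c \<in> C" and as: "a # s \<in> K c" for c a s
    proof -
      obtain q r t where c: "c = (q, r, t)" by (cases c)
      obtain x y where "a # s = zip (r @ x) (t @ y)" "path T q x y q\<^sub>1"
        "length (r @ x) = length (t @ y)" using as c by (auto simp: K_def)
      then show ?thesis using deriv[of q x y q\<^sub>1 r t a s] cC c by simp
    qed
  qed (use fin in simp)
  ultimately show ?thesis by simp
qed

lemma path_map:
  assumes "path T q x y q'" and "\<And>q x y q'. (q, x, y, q') \<in> T \<Longrightarrow> (g q, map h x, map k y, g q') \<in> T'"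
  shows "path T' (g q) (map h x) (map k y) (g q')"
  using assms(1)
proof induction
  case (path_step q x y q' u v q'')
  show ?case
    using path.path_step[OF assms(2)[OF path_step.hyps(1)] path_step.IH] by simp
qed (auto intro: path.intros)

text \<open>Since all pairs of the relation have the same length difference, the padding is a fixed pair of
  words, read by one extra transition at the end (for \<open>\<delta>\<^sub>R\<close>) or at the start (for \<open>\<delta>\<^sub>L\<close>).\<close>

lemma regular_delta_path:
  fixes T :: "('q \<times> 'a list \<times> 'a list \<times> 'q) set" and f :: "'q \<Rightarrow> int"
  assumes fin: "finite X" "finite T"
    and T: "\<And>q x y q'. (q, x, y, q') \<in> T \<Longrightarrow> x \<in> lists X \<and> y \<in> lists X"
    and f: "\<And>q x y q'. (q, x, y, q') \<in> T \<Longrightarrow> int (length x) + f q' = int (length y) + f q"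
  shows "regular_language (padded_alphabet X) (delta_R ` {(u, v). path T q\<^sub>0 u v q\<^sub>1})"
    and "regular_language (padded_alphabet X) (delta_L ` {(u, v). path T q\<^sub>0 u v q\<^sub>1})"
proof -
  \<comment> \<open>\<open>f q\<^sub>1 - f q\<^sub>0\<close> is the length of \<open>v\<close> minus
    that of \<open>u\<close>; \<open>nat\<close> cuts negative values to 0, so at most one of the
    two paddings is nonempty.\<close>
  define P :: "'a option list" where "P = replicate (nat (f q\<^sub>1 - f q\<^sub>0)) None"
  define P' :: "'a option list" where "P' = replicate (nat (f q\<^sub>0 - f q\<^sub>1)) None"
  define S where "S = (\<lambda>(q, x, y, q'). (Some q, map Some x, map Some y, Some q')) ` T"
  have SD: "\<exists>q\<^sub>2 x\<^sub>2 y\<^sub>2 q\<^sub>2'. (q\<^sub>2, x\<^sub>2, y\<^sub>2, q\<^sub>2') \<in> T \<and> q = Some q\<^sub>2 \<and> x = map Some x\<^sub>2 \<and> y = map Some y\<^sub>2 \<and> q' = Some q\<^sub>2'"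
    if "(q, x, y, q') \<in> S" for q x y q'
    using that by (force simp: S_def)
  define X' where "X' = insert None (Some ` X)"
  have padded: "padded_alphabet X = X' \<times> X'" by (simp add: padded_alphabet_def X'_def)
  have len: "int (length u) + f q\<^sub>1 = int (length v) + f q\<^sub>0" if "path T q\<^sub>0 u v q\<^sub>1" for u v
    using path_length[OF that f] .
  have pads: "delta_R (u, v) = zip (map Some u @ P) (map Some v @ P')"
    "delta_L (u, v) = zip (P @ map Some u) (P' @ map Some v)" if "path T q\<^sub>0 u v q\<^sub>1" for u v
  proof -
    have "max (length u) (length v) - length u = nat (f q\<^sub>1 - f q\<^sub>0)"
      "max (length u) (length v) - length v = nat (f q\<^sub>0 - f q\<^sub>1)"
      using len[OF that] by linarith+
    then show "delta_R (u, v) = zip (map Some u @ P) (map Some v @ P')"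
      "delta_L (u, v) = zip (P @ map Some u) (P' @ map Some v)"
      by (simp_all add: delta_R_def delta_L_def pad_right_def pad_left_def P_def P'_def Let_def)
  qed
  \<comment> \<open>\<open>None\<close> is a new state without exit in \<open>TR\<close> and without
    entry in \<open>TL\<close>, so the padding is read exactly once.\<close>
  define TR where "TR = insert (Some q\<^sub>1, P, P', None) S"
  define TL where "TL = insert (None, P, P', Some q\<^sub>0) S"
  have lift: "path TR (Some q) (map Some x) (map Some y) (Some q')"
     "path TL (Some q) (map Some x) (map Some y) (Some q')" if "path T q x y q'" for q x y q'
    using that by (force intro!: path_map[OF that] simp: TR_def TL_def S_def)+
  have None_TR: "x = [] \<and> y = []" if "path TR None x y q'" for x y q'
    using that by (cases rule: path.cases) (auto simp: TR_def dest: SD)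
  have R: "\<exists>u v. path T q u v q\<^sub>1 \<and> x = map Some u @ P \<and> y = map Some v @ P'"
    if "path TR (Some q) x y None" for q x y
    using that
  proof (induction "Some q :: 'q option" x y "None :: 'q option" arbitrary: q rule: path.induct)
    case (path_step x y q' u v)
    from path_step(1) consider "q = q\<^sub>1" "x = P" "y = P'" "q' = None" | "(Some q, x, y, q') \<in> S"
      by (auto simp: TR_def)
    then show ?case
    proof cases
      case 1
      then have "u = []" "v = []" using None_TR path_step(2) by blast+
      with 1 show ?thesis
        by (intro exI[of _ "[]"]) (auto intro: path.path_refl)
    next
      case 2
      then obtain q\<^sub>2 x\<^sub>2 y\<^sub>2 where *: "(q, x\<^sub>2, y\<^sub>2, q\<^sub>2) \<in> T" "x = map Some x\<^sub>2" "y = map Some y\<^sub>2" "q' = Some q\<^sub>2"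
        using SD by blast
      then obtain u\<^sub>2 v\<^sub>2 where "path T q\<^sub>2 u\<^sub>2 v\<^sub>2 q\<^sub>1" "u = map Some u\<^sub>2 @ P" "v = map Some v\<^sub>2 @ P'"
        using path_step(3) by blast
      with * show ?thesis
        by (intro exI[of _ "x\<^sub>2 @ u\<^sub>2"] exI[of _ "y\<^sub>2 @ v\<^sub>2"]) (auto intro: path.path_step)
    qed
  qed
  have L': "\<exists>u v. path T q u v q' \<and> x = map Some u \<and> y = map Some v"
    if "path TL (Some q) x y (Some q')" for q q' x y
    using that
  proof (induction "Some q :: 'q option" x y "Some q' :: 'q option" arbitrary: q rule: path.induct)
    case path_refl
    then show ?case by (intro exI[of _ "[]"]) (auto intro: path.path_refl)
  next
    case (path_step x y p u v)
    then have "(Some q, x, y, p) \<in> S" by (auto simp: TL_def)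
    then obtain q\<^sub>2 x\<^sub>2 y\<^sub>2 where *: "(q, x\<^sub>2, y\<^sub>2, q\<^sub>2) \<in> T" "x = map Some x\<^sub>2" "y = map Some y\<^sub>2" "p = Some q\<^sub>2"
      using SD by blast
    then obtain u\<^sub>2 v\<^sub>2 where "path T q\<^sub>2 u\<^sub>2 v\<^sub>2 q'" "u = map Some u\<^sub>2" "v = map Some v\<^sub>2"
      using path_step(3) by blast
    with * show ?case
      by (intro exI[of _ "x\<^sub>2 @ u\<^sub>2"] exI[of _ "y\<^sub>2 @ v\<^sub>2"]) (auto intro: path.path_step)
  qed
  have L: "\<exists>u v. path T q\<^sub>0 u v q\<^sub>1 \<and> x = P @ map Some u \<and> y = P' @ map Some v"
    if "path TL None x y (Some q\<^sub>1)" for x y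
    using that
  proof (cases rule: path.cases)
    case (path_step x' y' q' u v)
    then have "x' = P" "y' = P'" "q' = Some q\<^sub>0" by (auto simp: TL_def dest: SD)
    with path_step L' show ?thesis by blast
  qed
  have "delta_R ` {(u, v). path T q\<^sub>0 u v q\<^sub>1} = {zip x y | x y. path TR (Some q\<^sub>0) x y None}"
  proof (intro equalityI subsetI)
    fix z assume "z \<in> delta_R ` {(u, v). path T q\<^sub>0 u v q\<^sub>1}"
    then obtain u v where uv: "path T q\<^sub>0 u v q\<^sub>1" "z = delta_R (u, v)" by auto
    have "path TR (Some q\<^sub>1) P P' None" by (rule path_single) (simp add: TR_def)
    then show "z \<in> {zip x y | x y. path TR (Some q\<^sub>0) x y None}"
      using uv pads(1) path_trans[OF lift(1)] by blast
  next
    fix z assume "z \<in> {zip x y | x y. path TR (Some q\<^sub>0) x y None}"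
    then show "z \<in> delta_R ` {(u, v). path T q\<^sub>0 u v q\<^sub>1}"
      using R pads(1) by (force simp: image_iff)
  qed
  moreover define g :: "'q option \<Rightarrow> int" where
    "g = (\<lambda>p. case p of Some q \<Rightarrow> f q | None \<Rightarrow> f q\<^sub>0)"
  have "regular_language (X' \<times> X') {zip x y | x y. path TR (Some q\<^sub>0) x y None}"
  proof (rule regular_path[where f = g])
    show "finite TR" using fin by (simp add: TR_def S_def)
    fix q x y q' assume "(q, x, y, q') \<in> TR"
    then consider "q = Some q\<^sub>1" "x = P" "y = P'" "q' = None"
      | q\<^sub>2 x\<^sub>2 y\<^sub>2 q\<^sub>2' where "(q\<^sub>2, x\<^sub>2, y\<^sub>2, q\<^sub>2') \<in> T" "q = Some q\<^sub>2" "x = map Some x\<^sub>2" "y = map Some y\<^sub>2" "q' = Some q\<^sub>2'"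
      unfolding TR_def using SD by blast
    then show "x \<in> lists X' \<and> y \<in> lists X'" "int (length x) + g q' = int (length y) + g q"
      using T f by (cases; fastforce simp: P_def P'_def X'_def g_def)+
  qed (use fin in \<open>auto simp: X'_def g_def\<close>)
  ultimately show "regular_language (padded_alphabet X) (delta_R ` {(u, v). path T q\<^sub>0 u v q\<^sub>1})"
    by (simp add: padded)
  have "delta_L ` {(u, v). path T q\<^sub>0 u v q\<^sub>1} = {zip x y | x y. path TL None x y (Some q\<^sub>1)}"
  proof (intro equalityI subsetI)
    fix z assume "z \<in> delta_L ` {(u, v). path T q\<^sub>0 u v q\<^sub>1}"
    then obtain u v where uv: "path T q\<^sub>0 u v q\<^sub>1" "z = delta_L (u, v)" by auto
    have "path TL None P P' (Some q\<^sub>0)" by (rule path_single) (simp add: TL_def)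
    then show "z \<in> {zip x y | x y. path TL None x y (Some q\<^sub>1)}"
      using uv pads(2) path_trans[OF _ lift(2)] by blast
  next
    fix z assume "z \<in> {zip x y | x y. path TL None x y (Some q\<^sub>1)}"
    then show "z \<in> delta_L ` {(u, v). path T q\<^sub>0 u v q\<^sub>1}"
      using L pads(2) by (force simp: image_iff)
  qed
  moreover define g' :: "'q option \<Rightarrow> int" where
    "g' = (\<lambda>p. case p of Some q \<Rightarrow> f q | None \<Rightarrow> f q\<^sub>1)"
  have "regular_language (X' \<times> X') {zip x y | x y. path TL None x y (Some q\<^sub>1)}"
  proof (rule regular_path[where f = g'])
    show "finite TL" using fin by (simp add: TL_def S_def)
    fix q x y q' assume "(q, x, y, q') \<in> TL"
    then consider "q = None" "x = P" "y = P'" "q' = Some q\<^sub>0"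
      | q\<^sub>2 x\<^sub>2 y\<^sub>2 q\<^sub>2' where "(q\<^sub>2, x\<^sub>2, y\<^sub>2, q\<^sub>2') \<in> T" "q = Some q\<^sub>2" "x = map Some x\<^sub>2" "y = map Some y\<^sub>2" "q' = Some q\<^sub>2'"
      unfolding TL_def using SD by blast
    then show "x \<in> lists X' \<and> y \<in> lists X'" "int (length x) + g' q' = int (length y) + g' q"
      using T f by (cases; fastforce simp: P_def P'_def X'_def g'_def)+
  qed (use fin in \<open>auto simp: X'_def g'_def\<close>)
  ultimately show "regular_language (padded_alphabet X) (delta_L ` {(u, v). path T q\<^sub>0 u v q\<^sub>1})"
    by (simp add: padded)
qed

section \<open>Column insertion and the Knuth relations\<close>

definition col :: "nat set \<Rightarrow> nat list" where
  "col C = rev (sorted_list_of_set C)"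

lemma col_simps [simp]:
  assumes "finite C"
  shows "set (col C) = C" "sorted_wrt (>) (col C)" "length (col C) = card C"
  using assms strict_sorted_list_of_set[of C] by (auto simp: col_def sorted_wrt_rev)

lemma col_empty [simp]: "col {} = []"
  by (simp add: col_def)

lemma col_eqI:
  assumes "sorted_wrt (>) w"
  shows "col (set w) = w"
proof -
  have "sorted_wrt (<) (rev w)" using assms by (simp add: sorted_wrt_rev)
  then show ?thesis
    using sorted_list_of_set.idem_if_sorted_distinct[of "rev w"]
    by (simp add: col_def strict_sorted_iff)
qed

lemma column_iff: "column n \<alpha> \<longleftrightarrow> set \<alpha> \<subseteq> {1..n} \<and> sorted_wrt (>) \<alpha>"
  unfolding column_def in_lists_conv_set by blast

lemma column_eq_col: "column n \<alpha> \<longleftrightarrow> (\<exists>C\<subseteq>{1..n}. \<alpha> = col C)"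
proof
  assume "column n \<alpha>"
  then show "\<exists>C\<subseteq>{1..n}. \<alpha> = col C"
    unfolding column_iff by (metis col_eqI)
next
  assume "\<exists>C\<subseteq>{1..n}. \<alpha> = col C"
  then obtain C where C: "C \<subseteq> {1..n}" "\<alpha> = col C" by blast
  moreover from C(1) have "finite C" using finite_subset by blast
  ultimately show "column n \<alpha>" unfolding column_iff by (metis col_simps(1,2))
qed

text \<open>The expelled letter is a word of length at most one, which covers the case that nothing
  is expelled. A letter already present expels its own copy and leaves the column unchanged.\<close>

definition bump :: "nat \<Rightarrow> nat set \<Rightarrow> nat list \<times> nat set" where
  "bump a C = (if \<exists>e\<in>C. a \<le> e
     then let e = LEAST e. e \<in> C \<and> a \<le> e in ([e], insert a (C - {e})) else ([], insert a C))"

lemma bump_eq: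
  assumes "e \<in> C" "a \<le> e" "\<forall>x\<in>C. a \<le> x \<longrightarrow> e \<le> x"
  shows "bump a C = ([e], insert a (C - {e}))"
proof -
  have "(LEAST e. e \<in> C \<and> a \<le> e) = e"
    using assms by (intro Least_equality) auto
  moreover have "\<exists>e\<in>C. a \<le> e" using assms(1,2) by blast
  ultimately show ?thesis by (simp add: bump_def)
qed

lemma bump_top:
  assumes "\<forall>x\<in>C. x < a"
  shows "bump a C = ([], insert a C)"
proof -
  have "\<not> (\<exists>e\<in>C. a \<le> e)" using assms leD by blast
  then show ?thesis by (simp only: bump_def if_False)
qed

lemma bump_cases:
  obtains (bump) e where "e \<in> C" "a \<le> e" "\<forall>x\<in>C. a \<le> x \<longrightarrow> e \<le> x"
      "bump a C = ([e], insert a (C - {e}))"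
  | (top) "\<forall>x\<in>C. x < a" "bump a C = ([], insert a C)"
proof (cases "\<exists>e\<in>C. a \<le> e")
  case True
  define e where "e = (LEAST e. e \<in> C \<and> a \<le> e)"
  have "e \<in> C \<and> a \<le> e" unfolding e_def by (rule LeastI_ex) (use True in blast)
  moreover have "\<forall>x\<in>C. a \<le> x \<longrightarrow> e \<le> x"
    unfolding e_def by (simp add: Least_le)
  ultimately show ?thesis using bump[of e] bump_eq[of e C a] by simp
next
  case False
  then have "\<forall>x\<in>C. x < a" by (simp add: not_le)
  then show ?thesis using top bump_top[of C a] by simp
qed

text \<open>The word stands left of the column, so its last letter goes in first, and later expelled
  letters stand left of earlier ones: \<open>a w C\<close> becomes \<open>a D p\<close> and then
  \<open>E q p\<close>.\<close>

fun pass :: "nat list \<Rightarrow> nat set \<Rightarrow> nat list \<times> nat set" where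
  "pass [] C = ([], C)"
| "pass (a # w) C =
    (let (p, D) = pass w C; (q, E) = bump a D in (q @ p, E))"

lemma pass_append:
  "pass (u @ v) C = (let (p, D) = pass v C; (q, E) = pass u D in (q @ p, E))"
  by (induction u) (auto simp: Let_def split: prod.splits)

lemma bump_subset:
  assumes "bump a C = (p, D)"
  shows "set p \<subseteq> C" "D \<subseteq> insert a C"
  using assms by (cases a C rule: bump_cases; auto)+

lemma pass_lists:
  assumes "w \<in> lists X" "C \<subseteq> X" "pass w C = (p, D)"
  shows "p \<in> lists X \<and> D \<subseteq> X"
  using assms
proof (induction w arbitrary: p D)
  case (Cons a w)
  obtain q E where q: "pass w C = (q, E)" by fastforce
  obtain r F where r: "bump a E = (r, F)" by fastforce
  have "q \<in> lists X" "E \<subseteq> X" using Cons q by auto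
  moreover have "set r \<subseteq> E" "F \<subseteq> insert a E" using bump_subset[OF r] by auto
  moreover have "a \<in> X" "set p = set r \<union> set q" "D = F" using Cons q r by auto
  ultimately show ?case unfolding in_lists_conv_set by blast
qed auto

lemma bump_card:
  assumes "finite C" "bump a C = (p, D)"
  shows "length p + card D = Suc (card C)"
  using assms
proof (cases a C rule: bump_cases)
  case (bump e)
  have "a \<notin> C - {e}" using bump(2,3) by (metis DiffE insertI1 le_antisym le_refl)
  then show ?thesis using bump(1,4) assms card_Suc_Diff1[of C e] by simp
next
  case top
  then have "a \<notin> C" by blast
  then show ?thesis using top(2) assms by simp
qed

lemma pass_card:
  assumes "finite C" "pass w C = (p, D)"
  shows "finite D \<and> length p + card D = length w + card C"
  using assms(2)
proof (induction w arbitrary: p D)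
  case (Cons a w)
  obtain q E where q: "pass w C = (q, E)" by fastforce
  obtain r F where r: "bump a E = (r, F)" by fastforce
  have E: "finite E" "length q + card E = length w + card C" using Cons.IH[OF q] by simp_all
  moreover from E(1) have "finite F"
    by (intro finite_subset[OF bump_subset(2)[OF r]]) simp
  moreover have "p = r @ q" "D = F" using Cons.prems q r by auto
  ultimately show ?case using bump_card[OF E(1) r] by simp
qed (use assms in auto)

abbreviation plactic_eq :: "nat \<Rightarrow> nat list \<Rightarrow> nat list \<Rightarrow> bool" where
  "plactic_eq n u v \<equiv> (u, v) \<in> presented_cong {1..n} (plactic_rels n)"


lemma plactic_eq_lists: "plactic_eq n u v \<Longrightarrow> u \<in> lists {1..n} \<and> v \<in> lists {1..n}"
  by (induction rule: presented_cong.induct) (use plactic_rels_subset in auto)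

lemma knuth1:
  "x \<le> y \<Longrightarrow> y < z \<Longrightarrow> {x, y, z} \<subseteq> {1..n} \<Longrightarrow> plactic_eq n [x, z, y] [z, x, y]"
  by (rule presented_cong.rel) (auto simp: plactic_rels_def)

lemma knuth2:
  "x < y \<Longrightarrow> y \<le> z \<Longrightarrow> {x, y, z} \<subseteq> {1..n} \<Longrightarrow> plactic_eq n [y, x, z] [y, z, x]"
  by (rule presented_cong.rel) (auto simp: plactic_rels_def)

text \<open>Since \<open>e < z\<close>, the letter \<open>z\<close> acts strictly above
  \<open>e\<close> and neither insertion changes what the other meets; only the order of the
  expelled letters differs.\<close>

lemma bump_commute:
  assumes e: "e \<in> C" "x \<le> e" "\<forall>y\<in>C. x \<le> y \<longrightarrow> e \<le> y" and "e < z"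
    and z: "bump z C = (p, D)"
  shows "pass [x, z] C = (e # p, insert x (D - {e}))"
    and "pass [z, x] C = (p @ [e], insert x (D - {e}))"
proof -
  have x: "bump x C = ([e], insert x (C - {e}))" using e by (rule bump_eq)
  have "pass [x, z] C = (e # p, insert x (D - {e})) \<and> pass [z, x] C = (p @ [e], insert x (D - {e}))"
  proof (cases z C rule: bump_cases)
    case (bump f)
    have "bump x (insert z (C - {f})) = ([e], insert x (insert z (C - {f}) - {e}))"
      using bump e \<open>e < z\<close> by (intro bump_eq) auto
    moreover have "bump z (insert x (C - {e})) = ([f], insert z (insert x (C - {e}) - {f}))"
      using bump e \<open>e < z\<close> by (intro bump_eq) auto
    moreover have "insert z (insert x (C - {e}) - {f}) = insert x (insert z (C - {f}) - {e})"
      using bump e \<open>e < z\<close> by auto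
    ultimately show ?thesis using bump x z by auto
  next
    case top
    have "bump x (insert z C) = ([e], insert x (insert z C - {e}))"
      using top e \<open>e < z\<close> by (intro bump_eq) auto
    moreover have "bump z (insert x (C - {e})) = ([], insert z (insert x (C - {e})))"
      using top e \<open>e < z\<close> by (intro bump_top) auto
    moreover have "insert z (insert x (C - {e})) = insert x (insert z C - {e})"
      using \<open>e < z\<close> by auto
    ultimately show ?thesis using top x z by auto
  qed
  then show "pass [x, z] C = (e # p, insert x (D - {e}))"
    and "pass [z, x] C = (p @ [e], insert x (D - {e}))" by auto
qed

text \<open>All columns are considered because the prefix of a product meets whatever column the
  suffix leaves behind.\<close>

definition pass_equiv :: "nat \<Rightarrow> nat list \<Rightarrow> nat list \<Rightarrow> bool" where
  "pass_equiv n u v \<longleftrightarrow> (\<forall>C\<subseteq>{1..n}. snd (pass u C) = snd (pass v C) \<and>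
     plactic_eq n (fst (pass u C)) (fst (pass v C)))"

text \<open>Once \<open>y\<close> is in the column, \<open>x\<close> expels some
  \<open>e \<le> y < z\<close>, so \<open>x\<close> and \<open>z\<close> commute. The expelled words
  are equal or related by the first relation again.\<close>

lemma pass_knuth1:
  assumes "x \<le> y" "y < z" "{x, y, z} \<subseteq> {1..n}"
  shows "pass_equiv n [x, z, y] [z, x, y]"
  unfolding pass_equiv_def
proof (intro allI impI)
  fix C assume C: "C \<subseteq> {1..n}"
  obtain r D where r: "bump y C = (r, D)" by fastforce
  have D: "D \<subseteq> {1..n}" "y \<in> D" "set r \<subseteq> C"
    using bump_subset[OF r] C assms r by (cases y C rule: bump_cases; auto)+
  obtain e where e: "e \<in> D" "x \<le> e" "\<forall>w\<in>D. x \<le> w \<longrightarrow> e \<le> w"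
    using D(2) assms(1) by (cases x D rule: bump_cases) (auto dest: bspec)
  have ey: "e \<le> y" using e D assms by blast
  obtain p E where p: "bump z D = (p, E)" by fastforce
  have "pass [x, z] D = (e # p, insert x (E - {e}))" "pass [z, x] D = (p @ [e], insert x (E - {e}))"
    using bump_commute[OF e _ p] ey assms by auto
  then have out: "pass [x, z, y] C = (e # p @ r, insert x (E - {e}))"
      "pass [z, x, y] C = (p @ e # r, insert x (E - {e}))"
    using pass_append[of "[x, z]" "[y]" C] pass_append[of "[z, x]" "[y]" C] r
    by (auto simp: Let_def split: prod.splits)
  \<comment> \<open>If \<open>z\<close> expels \<open>f\<close> and \<open>y\<close> expels
    \<open>g\<close>, then \<open>e \<le> y \<le> g < f\<close>, as \<open>g\<close> is the least
    letter of \<open>C\<close> from \<open>y\<close> on and \<open>f\<close> is another one. If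
    \<open>y\<close> went on top, the larger \<open>z\<close> cannot expel anything.\<close>
  have "plactic_eq n (e # p @ r) (p @ e # r)"
  proof (cases z D rule: bump_cases)
    case (bump f)
    show ?thesis
    proof (cases y C rule: bump_cases)
      case b: (bump g)
      have "D = insert y (C - {g})" using b(4) r by simp
      moreover have "f \<noteq> y" "y \<le> f" using bump(2) assms(2) by linarith+
      ultimately have f: "f \<in> C" "f \<noteq> g" using bump(1) by blast+
      have "g \<le> f" using b(3) f(1) \<open>y \<le> f\<close> by blast
      then have "g < f" using f(2) by linarith
      moreover have "e \<le> g" using ey b(2) by linarith
      moreover have "{e, g, f} \<subseteq> {1..n}" using e(1) b(1) bump(1) C D by auto
      ultimately show ?thesis using knuth1[of e g f n] bump(4) b(4) p r by simp
    next
      case top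
      then have "D = insert y C" using r by simp
      then have "f \<le> y" using top(1) bump(1) by (metis insertE less_imp_le order_refl)
      then show ?thesis using bump(2) assms(2) by linarith
    qed
  next
    case top
    then have "p = []" using p by simp
    moreover have "e # r \<in> lists {1..n}" using e(1) D C by (auto simp: subset_iff)
    ultimately show ?thesis by (simp add: presented_cong.refl)
  qed
  then show "snd (pass [x, z, y] C) = snd (pass [z, x, y] C) \<and>
    plactic_eq n (fst (pass [x, z, y] C)) (fst (pass [z, x, y] C))"
    using out by simp
qed

text \<open>If \<open>C\<close> has a letter \<open>e\<close> with \<open>x \<le> e < z\<close>,
  then \<open>x\<close> and \<open>z\<close> act independently and the second relation reappears
  among the expelled letters. Otherwise both compete for the same letter, and it is the first
  relation that appears.\<close>

lemma pass_knuth2: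
  assumes xyz: "x < y" "y \<le> z" "{x, y, z} \<subseteq> {1..n}"
  shows "pass_equiv n [y, x, z] [y, z, x]"
  unfolding pass_equiv_def
proof (intro allI impI)
  fix C assume C: "C \<subseteq> {1..n}"
  let ?goal = "snd (pass [y, x, z] C) = snd (pass [y, z, x] C) \<and>
    plactic_eq n (fst (pass [y, x, z] C)) (fst (pass [y, z, x] C))"
  show ?goal
  proof (cases "\<exists>e\<in>C. x \<le> e \<and> e < z")
    case True
    then obtain e' where e': "e' \<in> C" "x \<le> e'" "e' < z" by blast
    obtain e where e: "e \<in> C" "x \<le> e" "\<forall>w\<in>C. x \<le> w \<longrightarrow> e \<le> w"
      using e'(1,2) by (cases x C rule: bump_cases) (auto dest: bspec)
    have ez: "e < z" using e(3) e' le_less_trans by blast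
    obtain p D where p: "bump z C = (p, D)" by fastforce
    \<comment> \<open>The column left by \<open>x\<close> and \<open>z\<close> in either order. It
      contains \<open>z \<ge> y\<close>, so \<open>y\<close> expels some \<open>f\<close> with
      \<open>e < f \<le> z\<close>.\<close>
    define N where "N = insert x (D - {e})"
    have "z \<in> D" using p by (cases z C rule: bump_cases) auto
    then have zN: "z \<in> N" using ez by (simp add: N_def)
    have "D \<subseteq> insert z C" using bump_subset(2)[OF p] .
    then have N: "N \<subseteq> insert x (insert z (C - {e}))" unfolding N_def by blast
    obtain f where f: "f \<in> N" "y \<le> f" "\<forall>w\<in>N. y \<le> w \<longrightarrow> f \<le> w"
        "bump y N = ([f], insert y (N - {f}))"
      using zN xyz(2) by (cases y N rule: bump_cases) (auto dest: bspec)
    have fz: "f \<le> z" using f(3) zN xyz(2) by blast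
    have "f \<noteq> x" using f(2) xyz(1) by linarith
    then have "f = z \<or> f \<in> C \<and> f \<noteq> e" using f(1) N by blast
    then have ef: "e < f" using ez e(3) f(2) xyz(1) by fastforce
    have fn: "e \<in> {1..n}" "f \<in> {1..n}"
      using e(1) C \<open>f = z \<or> f \<in> C \<and> f \<noteq> e\<close> xyz(3) by blast+
    have out: "pass [y, x, z] C = (f # e # p, insert y (N - {f}))"
        "pass [y, z, x] C = (f # p @ [e], insert y (N - {f}))"
      using bump_commute[OF e ez p] f(4) by (simp_all add: N_def)
    have "plactic_eq n (f # e # p) (f # p @ [e])"
    proof (cases z C rule: bump_cases)
      case (bump g)
      have "f \<le> g" using fz bump(2) by linarith
      moreover have "{e, f, g} \<subseteq> {1..n}" using fn bump(1) C by blast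
      ultimately show ?thesis using knuth2[OF ef] bump(4) p by simp
    next
      case top
      then have "p = []" using p by simp
      moreover have "[f, e] \<in> lists {1..n}" using fn by simp
      ultimately show ?thesis by (simp add: presented_cong.refl)
    qed
    then show ?thesis using out by simp
  next
    case False
    then have gap: "\<forall>w\<in>C. x \<le> w \<longrightarrow> z \<le> w" by (meson not_le_imp_less)
    show ?thesis
    proof (cases z C rule: bump_cases)
      case (bump e)
      have zC: "e = z" if "z \<in> C" using bump(2,3) that by (metis le_antisym order_refl)
      have ze: "\<forall>w\<in>C. x \<le> w \<longrightarrow> e \<le> w" using gap bump(3) by blast
      define D where "D = insert x (C - {e})"
      have "bump x (insert z (C - {e})) = ([z], insert x (insert z (C - {e}) - {z}))"
        using gap xyz(1,2) by (intro bump_eq) auto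
      moreover have "insert x (insert z (C - {e}) - {z}) = D"
        using zC by (auto simp: D_def)
      ultimately have xz: "pass [x, z] C = ([z, e], D)"
        using bump(4) by simp
      have "bump x C = ([e], D)"
        unfolding D_def using bump(1,2) ze xyz(1,2) by (intro bump_eq) auto
      then have x: "pass [x] C = ([e], D)" by simp
      have zD: "z \<notin> D" using zC xyz by (auto simp: D_def)
      have D: "D \<subseteq> {1..n}" using C xyz by (auto simp: D_def)
      show ?thesis
      proof (cases y D rule: bump_cases)
        \<comment> \<open>The two sides expel \<open>f z e\<close> and \<open>z f e\<close>, where
          \<open>z \<le> e < f\<close>.\<close>
        case f: (bump f)
        have "f \<in> C" "f \<noteq> e" using f(1,2) xyz(1) by (auto simp: D_def)
        then have "z \<le> f" using gap f(2) xyz(1) by simp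
        have "e \<le> f" using bump(3) \<open>f \<in> C\<close> \<open>z \<le> f\<close> by blast
        then have "e < f" using \<open>f \<noteq> e\<close> by simp
        have fD: "\<forall>w\<in>D. z \<le> w \<longrightarrow> f \<le> w" using f(3) xyz(2) by auto
        have "bump z D = ([f], insert z (D - {f}))"
          using f(1) fD \<open>z \<le> f\<close> by (intro bump_eq)
        moreover have "\<forall>w\<in>insert z (D - {f}). y \<le> w \<longrightarrow> z \<le> w"
          using f(3) \<open>z \<le> f\<close> by auto
        then have "bump y (insert z (D - {f})) = ([z], insert y (insert z (D - {f}) - {z}))"
          using xyz(2) by (intro bump_eq) auto
        moreover have "insert z (D - {f}) - {z} = D - {f}" using zD by auto
        ultimately have "pass [y, z, x] C = ([z, f, e], insert y (D - {f}))"
          using x by simp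
        moreover have "pass [y, x, z] C = ([f, z, e], insert y (D - {f}))"
          using xz f by simp
        moreover have "{z, e, f} \<subseteq> {1..n}" using bump(1) C \<open>f \<in> C\<close> xyz(3) by blast
        then have "plactic_eq n [z, f, e] [f, z, e]"
          using \<open>e < f\<close> bump(2) by (intro knuth1)
        ultimately show ?thesis by (simp add: presented_cong.sym)
      next
        case top
        have "bump z D = ([], insert z D)"
          using top(1) xyz(2) by (intro bump_top) (auto intro: less_le_trans)
        moreover have "bump y (insert z D) = ([z], insert y (insert z D - {z}))"
          using top(1) xyz(2) by (intro bump_eq) (auto dest: leD)
        moreover have "insert z D - {z} = D" using zD by auto
        ultimately have "pass [y, z, x] C = ([z, e], insert y D)"
          using x by simp
        moreover have "pass [y, x, z] C = ([z, e], insert y D)"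
          using xz top by simp
        moreover have "plactic_eq n [z, e] [z, e]"
          using bump(1) C xyz(3) by (intro presented_cong.refl) (auto simp: subset_iff)
        ultimately show ?thesis by simp
      qed
    next
      case top
      then have lt: "\<forall>w\<in>C. w < x" using gap by (meson leD le_less_linear)
      have zC: "z \<notin> C" using top by blast
      have "bump x (insert z C) = ([z], insert x (insert z C - {z}))"
        using lt xyz(1,2) by (intro bump_eq) (auto dest: leD)
      moreover have "insert z C - {z} = C" using zC by auto
      moreover have "bump y (insert x C) = ([], insert y (insert x C))"
        using lt xyz(1,2) by (intro bump_top) (auto dest: bspec)
      ultimately have 1: "pass [y, x, z] C = ([z], insert y (insert x C))"
        using top(2) by simp
      have "bump x C = ([], insert x C)" using lt by (intro bump_top)
      moreover have "bump z (insert x C) = ([], insert z (insert x C))"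
        using lt xyz(1,2) by (intro bump_top) (auto dest: bspec)
      moreover have "bump y (insert z (insert x C)) = ([z], insert y (insert z (insert x C) - {z}))"
        using lt xyz(1,2) by (intro bump_eq) (auto dest: leD)
      moreover have "insert z (insert x C) - {z} = insert x C" using zC xyz(1,2) by auto
      ultimately have "pass [y, z, x] C = ([z], insert y (insert x C))" by simp
      moreover have "plactic_eq n [z] [z]"
        using xyz(3) by (intro presented_cong.refl) (auto simp: subset_iff)
      ultimately show ?thesis using 1 by simp
    qed
  qed
qed

lemma pass_equiv_append:
  assumes "pass_equiv n u v" "pass_equiv n s t" "t \<in> lists {1..n}"
  shows "pass_equiv n (u @ s) (v @ t)"
  unfolding pass_equiv_def
proof (intro allI impI)
  fix C assume C: "C \<subseteq> {1..n}"
  obtain p D where s: "pass s C = (p, D)" by fastforce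
  obtain p' where t: "pass t C = (p', D)" "plactic_eq n p p'"
    using assms(2) C s unfolding pass_equiv_def by (metis fst_conv prod.collapse snd_conv)
  have D: "D \<subseteq> {1..n}" using pass_lists[OF assms(3) C t(1)] by simp
  have uv: "snd (pass u D) = snd (pass v D)" "plactic_eq n (fst (pass u D)) (fst (pass v D))"
    using assms(1) D unfolding pass_equiv_def by blast+
  have "pass (u @ s) C = (fst (pass u D) @ p, snd (pass u D))"
    "pass (v @ t) C = (fst (pass v D) @ p', snd (pass v D))"
    using s t(1) by (simp_all add: pass_append split_beta)
  then show "snd (pass (u @ s) C) = snd (pass (v @ t) C) \<and>
    plactic_eq n (fst (pass (u @ s) C)) (fst (pass (v @ t) C))"
    using uv presented_cong.append[OF uv(2) t(2)] by simp
qed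

lemma plactic_eq_pass: "plactic_eq n u v \<Longrightarrow> pass_equiv n u v"
proof (induction rule: presented_cong.induct)
  case (rel u v)
  then show ?case
    unfolding plactic_rels_def using pass_knuth1 pass_knuth2 by auto
next
  case (refl u)
  then show ?case
    unfolding pass_equiv_def using pass_lists[OF refl] by (metis presented_cong.refl prod.collapse)
next
  case (sym u v)
  then show ?case
    unfolding pass_equiv_def by (metis presented_cong.sym)
next
  case (trans u v w)
  then show ?case
    unfolding pass_equiv_def by (metis presented_cong.trans)
next
  case (append u v s t)
  then show ?case using pass_equiv_append plactic_eq_lists by blast
qed

section \<open>Columns inserted into columns\<close>

lemma col_unique: "sorted_wrt (>) w \<Longrightarrow> set w = C \<Longrightarrow> col C = w"
  using col_eqI by blast

lemma plactic_context:
  assumes "plactic_eq n u v" "p \<in> lists {1..n}" "s \<in> lists {1..n}"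
  shows "plactic_eq n (p @ u @ s) (p @ v @ s)"
  using presented_cong.append[OF presented_cong.refl[OF assms(2)]
      presented_cong.append[OF assms(1) presented_cong.refl[OF assms(3)]]] .

text \<open>\<open>a\<close> crosses each letter \<open>b\<close> by \<open>a b c = b a c\<close>,
  where the witness \<open>c\<close> is the letter after \<open>b\<close> and
  \<open>a \<le> e \<le> c < b\<close>. The last letter \<open>e\<close> serves only as a
  witness.\<close>

lemma slide_left:
  assumes "sorted_wrt (>) (w @ [e])" "a \<le> e" "set (a # w @ [e]) \<subseteq> {1..n}"
  shows "plactic_eq n (a # w @ [e]) (w @ [a, e])"
  using assms
proof (induction w)
  case Nil
  then have "[a, e] \<in> lists {1..n}" by simp
  from presented_cong.refl[OF this] show ?case by simp
next
  case (Cons b w)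
  obtain c r where c: "w @ [e] = c # r" by (cases w) auto
  have "c \<in> set (w @ [e])" unfolding c by simp
  then have cb: "c < b" and ec: "e \<le> c" and cn: "c \<in> {1..n}"
    using Cons.prems by (auto simp: sorted_wrt_append subset_iff)
  have rn: "r \<in> lists {1..n}"
  proof -
    have "set r \<subseteq> set (w @ [e])" unfolding c by auto
    then show ?thesis using Cons.prems(3) unfolding in_lists_conv_set by auto
  qed
  have "plactic_eq n ([a, b, c] @ r) ([b, a, c] @ r)"
    using plactic_context[OF knuth1[of a c b n], of "[]" r] cb ec cn rn Cons.prems(2,3) by simp
  then have 1: "plactic_eq n (a # (b # w) @ [e]) ([b] @ a # w @ [e])" using c by simp
  have 2: "plactic_eq n ([b] @ a # w @ [e]) ([b] @ w @ [a, e])"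
  proof (rule presented_cong.append)
    show "plactic_eq n [b] [b]" using Cons.prems(3) by (intro presented_cong.refl) simp
    show "plactic_eq n (a # w @ [e]) (w @ [a, e])" using Cons.IH Cons.prems by simp
  qed
  show ?case using presented_cong.trans[OF 1 2] by simp
qed

text \<open>\<open>e\<close> crosses each letter \<open>c\<close> by \<open>a e c = a c e\<close>,
  where the witness \<open>a\<close> is the letter in front and \<open>c < a \<le> e\<close>; then
  \<open>c\<close> is the next witness.\<close>

lemma slide_right:
  assumes "sorted_wrt (>) (a # w)" "a \<le> e" "set (a # e # w) \<subseteq> {1..n}"
  shows "plactic_eq n (a # e # w) (a # w @ [e])"
  using assms
proof (induction w arbitrary: a)
  case Nil
  then have "[a, e] \<in> lists {1..n}" by simp
  from presented_cong.refl[OF this] show ?case by simp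
next
  case (Cons c w)
  have wn: "w \<in> lists {1..n}" using Cons.prems(3) unfolding in_lists_conv_set by auto
  have "plactic_eq n [a, c, e] [a, e, c]"
    using Cons.prems by (intro knuth2) auto
  from plactic_context[OF presented_cong.sym[OF this], of "[]" w] wn
  have 1: "plactic_eq n (a # e # c # w) ([a] @ c # e # w)" by simp
  have 2: "plactic_eq n ([a] @ c # e # w) ([a] @ c # w @ [e])"
  proof (rule presented_cong.append)
    show "plactic_eq n [a] [a]" using Cons.prems(3) by (intro presented_cong.refl) simp
    show "plactic_eq n (c # e # w) (c # w @ [e])" using Cons.IH[of c] Cons.prems by simp
  qed
  show ?case using presented_cong.trans[OF 1 2] by simp
qed

text \<open>Write \<open>C\<close> as \<open>B e A\<close> with \<open>A\<close> below
  \<open>a\<close> and \<open>B\<close> above \<open>e\<close>. Then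
  \<open>a B e A = B a e A\<close> by \<open>slide_left\<close>, and this is \<open>B a A e\<close>
  by \<open>slide_right\<close>.\<close>

lemma bump_plactic_eq:
  assumes C: "C \<subseteq> {1..n}" and a: "a \<in> {1..n}" and D: "bump a C = (p, D)"
  shows "plactic_eq n (a # col C) (col D @ p)"
proof (cases a C rule: bump_cases)
  case (bump e)
  have fin: "finite C" using C finite_subset by blast
  define B where "B = {w \<in> C. e < w}"
  define A where "A = {w \<in> C. w < a}"
  have finAB: "finite A" "finite B" using fin by (simp_all add: A_def B_def)
  have AB: "\<forall>x\<in>A. x < a" "\<forall>x\<in>B. e < x" "A \<subseteq> C" "B \<subseteq> C"
    by (auto simp: A_def B_def)
  have C_eq: "C = insert e (A \<union> B)"
  proof (intro equalityI subsetI)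
    fix x assume x: "x \<in> C"
    then have "x < a \<or> e \<le> x" using bump(3) by (meson not_le_imp_less)
    then consider "x < a" | "x = e" | "e < x" by linarith
    then show "x \<in> insert e (A \<union> B)" by cases (simp_all add: x A_def B_def)
  qed (use bump(1) AB in blast)
  have "e \<notin> A \<union> B" using bump(2) AB(1,2) by (auto dest: bspec)
  then have "C - {e} = A \<union> B" unfolding C_eq by blast
  then have D_eq: "D = insert a (A \<union> B)" using bump(4) D by simp
  have colC: "col C = col B @ e # col A" and colD: "col D = col B @ a # col A"
  proof -
    have "y < x" if "x \<in> B" "y \<in> A" for x y
      using AB(1,2) bump(2) that by (meson less_le_trans less_trans)
    moreover have "\<forall>x\<in>B. a < x" "\<forall>x\<in>A. x < e" using AB(1,2) bump(2) by auto
    ultimately show "col C = col B @ e # col A" "col D = col B @ a # col A"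
      using finAB AB(1,2) unfolding C_eq D_eq
      by (auto intro!: col_unique simp: sorted_wrt_append)
  qed
  have en: "e \<in> {1..n}" using bump(1) C by blast
  have An: "set (col A) \<subseteq> {1..n}" and Bn: "set (col B) \<subseteq> {1..n}"
    using finAB AB(3,4) C by auto
  have "plactic_eq n (a # col B @ [e]) (col B @ [a, e])"
    using finAB AB(2) bump(2) en a Bn by (intro slide_left) (simp_all add: sorted_wrt_append)
  from plactic_context[OF this, of "[]" "col A"] An
  have 1: "plactic_eq n (a # col C) (col B @ a # e # col A)"
    by (simp add: colC in_lists_conv_set subset_iff)
  have "plactic_eq n (a # e # col A) (a # col A @ [e])"
    using finAB AB(1) bump(2) en a An by (intro slide_right) simp_all
  from plactic_context[OF this, of "col B" "[]"] Bn
  have 2: "plactic_eq n (col B @ a # e # col A) (col D @ [e])"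
    by (simp add: colD in_lists_conv_set subset_iff)
  show ?thesis using bump(4) D presented_cong.trans[OF 1 2] by simp
next
  case top
  have fin: "finite C" using C finite_subset by blast
  have "col D = a # col C"
    using top D fin by (intro col_unique) auto
  moreover have "a # col C \<in> lists {1..n}" using C a fin by auto
  ultimately show ?thesis using top(2) D presented_cong.refl[of "a # col C"] by simp
qed

lemma pass_plactic_eq:
  assumes "C \<subseteq> {1..n}" "set w \<subseteq> {1..n}" "pass w C = (p, D)"
  shows "plactic_eq n (w @ col C) (col D @ p)"
  using assms(2,3)
proof (induction w arbitrary: p D)
  case Nil
  have "finite C" using assms(1) finite_subset by blast
  then have "col C \<in> lists {1..n}"
    using assms(1) unfolding in_lists_conv_set by (metis col_simps(1) subsetD)
  from presented_cong.refl[OF this] show ?case using Nil by simp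
next
  case (Cons a w)
  obtain q E where q: "pass w C = (q, E)" by fastforce
  obtain r F where r: "bump a E = (r, F)" by fastforce
  have "w \<in> lists {1..n}" using Cons.prems(1) unfolding in_lists_conv_set by auto
  then have qE: "q \<in> lists {1..n}" "E \<subseteq> {1..n}"
    using pass_lists[OF _ assms(1) q] by blast+
  have a: "a \<in> {1..n}" using Cons.prems(1) by simp
  have "plactic_eq n (w @ col C) (col E @ q)" using Cons.IH[OF _ q] Cons.prems(1) by simp
  from plactic_context[OF this, of "[a]" "[]"] a
  have 1: "plactic_eq n ((a # w) @ col C) (a # col E @ q)" by simp
  have 2: "plactic_eq n (a # col E @ q) (col F @ r @ q)"
    using plactic_context[OF bump_plactic_eq[OF qE(2) a r], of "[]" q] qE(1) by simp
  have "p = r @ q" "D = F" using Cons.prems(2) q r by auto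
  then show ?case using presented_cong.trans[OF 1 2] by simp
qed

section \<open>Counting functions and the order on columns\<close>

definition cnt :: "nat set \<Rightarrow> nat \<Rightarrow> nat" where
  "cnt C t = card (C \<inter> {..t})"

text \<open>The order on columns with its arguments exchanged. Unlike a comparison by index, counts
  add up over disjoint unions and change by one on insertion.\<close>

definition dom_le :: "nat set \<Rightarrow> nat set \<Rightarrow> bool" where
  "dom_le D C \<longleftrightarrow> (\<forall>t. cnt D t \<le> cnt C t)"

lemma dom_le_refl [simp]: "dom_le C C"
  by (simp add: dom_le_def)

lemma dom_le_trans: "dom_le E D \<Longrightarrow> dom_le D C \<Longrightarrow> dom_le E C"
  unfolding dom_le_def using le_trans by blast

lemma dom_le_empty [simp]: "dom_le {} C"
  by (simp add: dom_le_def cnt_def)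

lemma dom_le_subset: "finite C \<Longrightarrow> D \<subseteq> C \<Longrightarrow> dom_le D C"
  unfolding dom_le_def cnt_def by (auto intro!: card_mono)

lemma dom_le_emptyD:
  assumes "dom_le D {}" "finite D"
  shows "D = {}"
proof (rule ccontr)
  assume "D \<noteq> {}"
  then obtain x where "x \<in> D" by blast
  then have "D \<inter> {..x} \<noteq> {}" by auto
  then have "cnt D x \<noteq> 0" using assms(2) by (simp add: cnt_def)
  then show False using assms(1) by (simp add: dom_le_def cnt_def)
qed

lemma cnt_Un: "finite C \<Longrightarrow> finite D \<Longrightarrow> C \<inter> D = {} \<Longrightarrow> cnt (C \<union> D) t = cnt C t + cnt D t"
  unfolding cnt_def by (subst card_Un_disjoint[symmetric]) (auto simp: Int_Un_distrib2)

lemma cnt_insert: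
  "finite C \<Longrightarrow> a \<notin> C \<Longrightarrow> cnt (insert a C) t = cnt C t + (if a \<le> t then 1 else 0)"
  unfolding cnt_def by (simp add: Int_insert_left)

lemma cnt_remove:
  assumes "finite C" "e \<in> C"
  shows "cnt C t = cnt (C - {e}) t + (if e \<le> t then 1 else 0)"
  using cnt_insert[of "C - {e}" e t] assms by (simp add: insert_absorb)

text \<open>Increasing enumeration and counting function are inverse to each other in this sense,
  which links the index definition of \<open>\<succeq>\<close> to counts.\<close>

lemma less_cnt_iff_nth:
  assumes "sorted_wrt (<) xs"
  shows "i < cnt (set xs) t \<longleftrightarrow> i < length xs \<and> xs ! i \<le> t"
  using assms
proof (induction xs arbitrary: i)
  case (Cons a ys)
  have "a \<notin> set ys" using Cons.prems by auto
  then have "cnt (set (a # ys)) t = cnt (set ys) t + (if a \<le> t then 1 else 0)"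
    by (simp add: cnt_insert)
  moreover have "cnt (set ys) t = 0" if "t < a"
  proof -
    have "set ys \<inter> {..t} = {}" using that Cons.prems by fastforce
    then show ?thesis by (simp add: cnt_def)
  qed
  moreover have "a < ys ! j" if "j < length ys" for j using Cons.prems that by simp
  moreover have "j < cnt (set ys) t \<longleftrightarrow> j < length ys \<and> ys ! j \<le> t" for j
    using Cons.IH Cons.prems by simp
  ultimately show ?case by (cases i; cases "a \<le> t") (force dest: less_imp_le)+
qed (simp add: cnt_def)

lemma column_succeq_iff:
  assumes "finite C" "finite D"
  shows "col C \<succeq> col D \<longleftrightarrow> dom_le D C"
proof -
  define xs where "xs = sorted_list_of_set C"
  define ys where "ys = sorted_list_of_set D"
  have xs: "sorted_wrt (<) xs" "set xs = C" and ys: "sorted_wrt (<) ys" "set ys = D"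
    using assms by (simp_all add: xs_def ys_def)
  have "col C \<succeq> col D \<longleftrightarrow> (\<forall>i<length ys. i < length xs \<and> xs ! i \<le> ys ! i)"
    unfolding column_succeq_def col_def xs_def[symmetric] ys_def[symmetric] rev_rev_ident length_rev
    by (meson le_less_linear less_irrefl_nat order_less_le_trans)
  also have "\<dots> \<longleftrightarrow> (\<forall>t. cnt D t \<le> cnt C t)"
  proof
    assume *: "\<forall>i<length ys. i < length xs \<and> xs ! i \<le> ys ! i"
    show "\<forall>t. cnt D t \<le> cnt C t"
    proof (intro allI leI notI)
      fix t assume "cnt C t < cnt D t"
      \<comment> \<open>The letter of \<open>D\<close> with index \<open>cnt C t\<close> is at most
        \<open>t\<close>, hence so is that of \<open>C\<close>, against the count of
        \<open>C\<close>.\<close>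
      then show False
        using less_cnt_iff_nth[OF ys(1), of "cnt C t" t] less_cnt_iff_nth[OF xs(1), of "cnt C t" t]
          * le_trans xs ys by auto
    qed
  next
    assume *: "\<forall>t. cnt D t \<le> cnt C t"
    show "\<forall>i<length ys. i < length xs \<and> xs ! i \<le> ys ! i"
    proof (intro allI impI)
      fix i assume "i < length ys"
      then have "i < cnt D (ys ! i)" using less_cnt_iff_nth[OF ys(1)] ys(2) by simp
      also have "\<dots> \<le> cnt C (ys ! i)" using * by simp
      finally show "i < length xs \<and> xs ! i \<le> ys ! i" using less_cnt_iff_nth[OF xs(1)] xs(2) by simp
    qed
  qed
  finally show ?thesis by (simp add: dom_le_def)
qed

text \<open>Inserting a column into a column matches each letter, from the smallest on, with the least
  available larger letter of the second column; \<open>E\<close> is the set of matched letters.\<close>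

lemma pass_column:
  assumes "sorted_wrt (>) w" "finite D"
  obtains E where "E \<subseteq> D" "pass w D = (col E, set w \<union> (D - E))" "set w \<inter> (D - E) = {}"
    "dom_le E (set w)" "\<forall>y\<in>D - E. cnt (set w) y \<le> cnt E y"
proof -
  \<comment> \<open>The last clause serves the induction: it makes each newly matched letter exceed
    the earlier ones, so the expelled word is a column. The clause before it holds because an
    unmatched \<open>y\<close> was available to every letter of \<open>w\<close> up to
    \<open>y\<close>, whose match is thus at most \<open>y\<close>.\<close>
  have "\<exists>E\<subseteq>D. pass w D = (col E, set w \<union> (D - E)) \<and> set w \<inter> (D - E) = {} \<and>
    dom_le E (set w) \<and> (\<forall>y\<in>D - E. cnt (set w) y \<le> cnt E y) \<and>
    (\<forall>y\<in>D - E. \<forall>x\<in>E. y < x \<longrightarrow> (\<exists>b\<in>set w. y < b))"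
    using assms(1)
  proof (induction w)
    case Nil
    show ?case by (rule exI[of _ "{}"]) (simp add: cnt_def)
  next
    case (Cons a w)
    then obtain E where E: "E \<subseteq> D" "pass w D = (col E, set w \<union> (D - E))" "set w \<inter> (D - E) = {}"
      "dom_le E (set w)" "\<forall>y\<in>D - E. cnt (set w) y \<le> cnt E y"
      "\<forall>y\<in>D - E. \<forall>x\<in>E. y < x \<longrightarrow> (\<exists>b\<in>set w. y < b)" by auto
    have fin: "finite E" using E(1) assms(2) finite_subset by blast
    have wa: "\<forall>b\<in>set w. b < a" using Cons.prems by simp
    then have "a \<notin> set w" by blast
    then have cnt_w: "cnt (set (a # w)) t = cnt (set w) t + (if a \<le> t then 1 else 0)" for t
      by (simp add: cnt_insert)
    show ?case
    proof (cases a "set w \<union> (D - E)" rule: bump_cases)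
      case (bump e)
      have e: "e \<in> D - E" using bump(1,2) wa by (metis Un_iff leD)
      have gt: "\<forall>x\<in>E. x < e"
      proof
        fix x assume "x \<in> E"
        have "\<not> e < x" using E(6) e \<open>x \<in> E\<close> wa bump(2) by (meson leD less_trans)
        moreover have "x \<noteq> e" using e \<open>x \<in> E\<close> by blast
        ultimately show "x < e" by simp
      qed
      have col: "col (insert e E) = e # col E"
        using gt fin by (intro col_unique) auto
      have cnt_E: "cnt (insert e E) t = cnt E t + (if e \<le> t then 1 else 0)" for t
        using fin e by (simp add: cnt_insert)
      have DE: "D - insert e E = D - E - {e}" by blast
      have lt: "e < y" if "y \<in> D - insert e E" "a \<le> y" for y
        using bump(3) that by (metis DiffE DiffI UnI2 insertCI le_neq_implies_less)
      have sets: "insert a (set w \<union> (D - E) - {e}) = set (a # w) \<union> (D - insert e E)"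
        using e E(3) by auto
      show ?thesis
      proof (intro exI[of _ "insert e E"] conjI)
        show "insert e E \<subseteq> D" using e E(1) by blast
        show "pass (a # w) D = (col (insert e E), set (a # w) \<union> (D - insert e E))"
          using E(2) bump(4) col sets by simp
        show "set (a # w) \<inter> (D - insert e E) = {}"
          using E(3) bump(3) e lt bump(2) by (auto dest: leD)
        show "dom_le (insert e E) (set (a # w))"
          using E(4) bump(2) unfolding dom_le_def cnt_w cnt_E by (auto intro: le_SucI)
        show "\<forall>y\<in>D - insert e E. cnt (set (a # w)) y \<le> cnt (insert e E) y"
          using E(5) lt unfolding cnt_w cnt_E by (auto intro: le_SucI dest: less_imp_le)
        show "\<forall>y\<in>D - insert e E. \<forall>x\<in>insert e E. y < x \<longrightarrow> (\<exists>b\<in>set (a # w). y < b)"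
        proof (intro ballI impI)
          fix y x assume *: "y \<in> D - insert e E" "x \<in> insert e E" "y < x"
          show "\<exists>b\<in>set (a # w). y < b"
          proof (cases "x = e")
            case True
            then have "y < a" using lt[OF *(1)] *(3) by force
            then show ?thesis by simp
          next
            case False
            then show ?thesis using E(6) * by auto
          qed
        qed
      qed
    next
      case top
      have lt: "\<forall>y\<in>D - E. y < a" using top(1) by blast
      show ?thesis
      proof (intro exI[of _ E] conjI)
        show "E \<subseteq> D" by fact
        show "pass (a # w) D = (col E, set (a # w) \<union> (D - E))"
          using E(2) top(2) by simp
        show "set (a # w) \<inter> (D - E) = {}" using E(3) lt by auto
        show "dom_le E (set (a # w))"
          using E(4) unfolding dom_le_def cnt_w by (auto intro: le_SucI)
        show "\<forall>y\<in>D - E. cnt (set (a # w)) y \<le> cnt E y"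
          using E(5) lt unfolding cnt_w by (auto dest: leD)
        show "\<forall>y\<in>D - E. \<forall>x\<in>E. y < x \<longrightarrow> (\<exists>b\<in>set (a # w). y < b)"
          using E(6) by auto
      qed
    qed
  qed
  then show ?thesis using that by blast
qed

section \<open>Tableaux as normal forms\<close>

lemma cnt_mono: "s \<le> t \<Longrightarrow> cnt C s \<le> cnt C t"
  unfolding cnt_def by (auto intro!: card_mono)

lemma dom_le_card:
  assumes "dom_le D C" "finite D" "finite C"
  shows "card D \<le> card C"
proof -
  define t where "t = Max (insert 0 (D \<union> C))"
  have "\<forall>x\<in>D \<union> C. x \<le> t" unfolding t_def using assms(2,3) by simp
  then have "D \<inter> {..t} = D" "C \<inter> {..t} = C" by auto
  then show ?thesis using assms(1) unfolding dom_le_def cnt_def by metis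
qed

text \<open>Row insertion across a column: if the letter \<open>c\<close> arrives in the column \<open>B\<close> right of \<open>A\<close>, then
  at most one letter of \<open>B \<union> c\<close> remains unmatched and moves on into \<open>A\<close>. Absent letters are handled
  uniformly by carrying words of length at most one.\<close>

lemma row_step:
  assumes fin: "finite A" "finite B" and BA: "dom_le B A" and c: "set c \<inter> B = {}"
  obtains E d where "pass (col A) (B \<union> set c) = (col E, A \<union> set d)" "set d \<inter> A = {}"
    "length d \<le> length c" "set d \<subseteq> B \<union> set c" "E = B \<union> set c - set d" "dom_le E A" "dom_le B E"
proof -
  define D where "D = B \<union> set c"
  have finD: "finite D" using fin by (simp add: D_def)
  obtain E where E: "E \<subseteq> D" "pass (col A) D = (col E, A \<union> (D - E))" "A \<inter> (D - E) = {}"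
    "dom_le E A" "\<forall>y\<in>D - E. cnt A y \<le> cnt E y"
    using pass_column[of "col A" D] finD fin(1) by (metis col_simps(1,2))
  define Y where "Y = D - E"
  have finEY: "finite E" "finite Y" using finD E(1) finite_subset by (auto simp: Y_def)
  have "cnt D t = cnt B t + cnt (set c) t" for t
    unfolding D_def using fin c by (intro cnt_Un) auto
  moreover have "cnt D t = cnt E t + cnt Y t" for t
    using cnt_Un[OF finEY] E(1) by (simp add: Y_def Un_absorb1)
  ultimately have sum: "cnt E t + cnt Y t = cnt B t + cnt (set c) t" for t by metis
  \<comment> \<open>\<open>cnt A y \<le> cnt E y\<close> is known only at unmatched letters, so the
    estimate is made at the largest \<open>y\<close> of \<open>Y\<close> up to \<open>t\<close>:
    there \<open>cnt B y \<le> cnt A y \<le> cnt E y\<close>, and \<open>sum\<close> gives the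
    claim.\<close>
  have Yc: "dom_le Y (set c)"
    unfolding dom_le_def
  proof
    fix t
    show "cnt Y t \<le> cnt (set c) t"
    proof (cases "Y \<inter> {..t} = {}")
      case True
      then show ?thesis by (simp add: cnt_def)
    next
      case False
      define y where "y = Max (Y \<inter> {..t})"
      have y: "y \<in> Y" "y \<le> t" using Max_in[OF _ False] finEY by (simp_all add: y_def)
      have "x \<le> y" if "x \<in> Y" "x \<le> t" for x
        unfolding y_def using that finEY by (intro Max_ge) auto
      then have "Y \<inter> {..t} = Y \<inter> {..y}" using y(2) by auto
      then have "cnt Y t = cnt Y y" by (simp add: cnt_def)
      also have "\<dots> \<le> cnt (set c) y"
        using sum[of y] E(5) y(1) BA unfolding dom_le_def Y_def[symmetric]
        by (metis add_le_cancel_left add_mono le_trans order_refl)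
      also have "\<dots> \<le> cnt (set c) t" using y(2) by (rule cnt_mono)
      finally show ?thesis .
    qed
  qed
  show ?thesis
  proof (rule that)
    show "pass (col A) (B \<union> set c) = (col E, A \<union> set (col Y))"
      using E(2) finEY by (simp add: D_def Y_def)
    show "set (col Y) \<inter> A = {}" using E(3) finEY by (auto simp: Y_def)
    show "length (col Y) \<le> length c"
      using dom_le_card[OF Yc finEY(2)] finEY card_length[of c] by simp
    show "set (col Y) \<subseteq> B \<union> set c" using finEY by (auto simp: Y_def D_def)
    show "E = B \<union> set c - set (col Y)" using finEY E(1) by (auto simp: Y_def D_def)
    show "dom_le B E"
      unfolding dom_le_def using sum Yc unfolding dom_le_def by (metis add_le_cancel_right add_mono order_refl)
  qed (fact E(4))
qed

text \<open>Unmatched letters avoid \<open>A\<close> but lie in \<open>D\<close>, hence in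
  \<open>A\<close>; so there are none. This makes the imaginary full column harmless.\<close>

lemma pass_column_subset:
  assumes "finite A" "D \<subseteq> A"
  shows "pass (col A) D = (col D, A)"
proof -
  have fin: "finite D" using assms finite_subset by blast
  obtain E where E: "E \<subseteq> D" "pass (col A) D = (col E, A \<union> (D - E))" "A \<inter> (D - E) = {}"
    using pass_column[of "col A" D] fin assms(1) by (metis col_simps(1,2))
  then have "E = D" using assms(2) by blast
  with E(2) show ?thesis by simp
qed

text \<open>Inserting \<open>x\<close> raises the count only at bounds \<open>t\<close> from
  \<open>x\<close> up to the expelled letter. There \<open>B\<close> has no letter between
  \<open>x\<close> and \<open>t\<close>, so it has as many letters as below \<open>x\<close>, where
  \<open>A\<close> has no fewer, and \<open>A\<close> gains \<open>x\<close> in addition. This is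
  why the carried letter must come from \<open>A\<close>; \<open>set d \<subseteq> B\<close> hands
  the condition on.\<close>

lemma column_step:
  assumes pass: "pass c B = (d, E)" and c: "length c \<le> 1" "set c \<subseteq> A"
    and fin: "finite A" "finite B" and BA: "dom_le B A"
  shows "dom_le E A" "dom_le B E" "set d \<subseteq> B" "length d \<le> 1"
proof -
  consider "c = []" | x where "c = [x]" using c(1) by (cases c) auto
  then have "dom_le E A \<and> dom_le B E \<and> set d \<subseteq> B \<and> length d \<le> 1"
  proof cases
    case 1
    then show ?thesis using pass BA by simp
  next
    case (2 x)
    have xA: "x \<in> A" using c(2) 2 by simp
    have bump: "bump x B = (d, E)" using pass 2 by simp
    have gap: "Suc (cnt B t) \<le> cnt A t" if "x \<le> t" "\<forall>w\<in>B. w \<le> t \<longrightarrow> w < x" for t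
    proof (cases x)
      \<comment> \<open>There is no bound \<open>x - 1\<close>; instead \<open>B\<close> has no
        letter up to \<open>t\<close> at all.\<close>
      case 0
      then have "B \<inter> {..t} = {}" using that(2) by auto
      moreover have "A \<inter> {..t} \<noteq> {}" using xA that(1) by auto
      ultimately show ?thesis using fin(1) by (simp add: cnt_def card_gt_0_iff Suc_leI)
    next
      case (Suc m)
      have "B \<inter> {..t} = B \<inter> {..m}" using that Suc by auto
      then have "cnt B t = cnt B m" by (simp add: cnt_def)
      also have "\<dots> \<le> cnt A m" using BA by (simp add: dom_le_def)
      finally have le: "cnt B t \<le> cnt A m" .
      have "A \<inter> {..m} \<subset> A \<inter> {..t}"
      proof
        show "A \<inter> {..m} \<subseteq> A \<inter> {..t}" using that(1) Suc by auto
        have "x \<in> A \<inter> {..t}" "x \<notin> A \<inter> {..m}" using xA that(1) Suc by auto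
        then show "A \<inter> {..m} \<noteq> A \<inter> {..t}" by blast
      qed
      then have "cnt A m < cnt A t"
        unfolding cnt_def using fin(1) by (intro psubset_card_mono) auto
      with le show ?thesis by simp
    qed
    have cntBA: "cnt B t \<le> cnt A t" for t using BA by (simp add: dom_le_def)
    show ?thesis
    proof (cases x B rule: bump_cases)
      case (bump e)
      have de: "d = [e]" "E = insert x (B - {e})" using bump(4) \<open>bump x B = (d, E)\<close> by auto
      have "x \<notin> B - {e}" using bump(2,3) by (metis DiffE insertI1 le_antisym le_refl)
      then have cntE: "cnt E t = cnt (B - {e}) t + (if x \<le> t then 1 else 0)" for t
        unfolding de(2) using fin(2) by (intro cnt_insert) auto
      have cntB: "cnt B t = cnt (B - {e}) t + (if e \<le> t then 1 else 0)" for t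
        using fin(2) bump(1) by (rule cnt_remove)
      have "cnt E t \<le> cnt A t" for t
      proof (cases "x \<le> t \<and> t < e")
        case True
        then have "\<forall>w\<in>B. w \<le> t \<longrightarrow> w < x" using bump(3) by (meson leD le_less_linear le_trans)
        then have "Suc (cnt B t) \<le> cnt A t" using gap True by blast
        then show ?thesis using cntE[of t] cntB[of t] True by simp
      next
        case False
        then have "cnt E t = cnt B t" using cntE[of t] cntB[of t] bump(2) by auto
        then show ?thesis using cntBA by simp
      qed
      moreover have "cnt B t \<le> cnt E t" for t using cntE[of t] cntB[of t] bump(2) by auto
      ultimately show ?thesis using de(1) bump(1) by (simp add: dom_le_def)
    next
      case top
      have de: "d = []" "E = insert x B" using top(2) \<open>bump x B = (d, E)\<close> by auto
      have "x \<notin> B" using top(1) by blast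
      then have cntE: "cnt E t = cnt B t + (if x \<le> t then 1 else 0)" for t
        unfolding de(2) using fin(2) by (intro cnt_insert)
      have "cnt E t \<le> cnt A t" for t
        using cntE[of t] gap[of t] top(1) cntBA[of t] by auto
      moreover have "cnt B t \<le> cnt E t" for t using cntE[of t] by simp
      ultimately show ?thesis using de(1) by (simp add: dom_le_def)
    qed
  qed
  then show "dom_le E A" "dom_le B E" "set d \<subseteq> B" "length d \<le> 1" by blast+
qed

abbreviation tableau :: "nat set list \<Rightarrow> bool" where
  "tableau \<equiv> sorted_wrt (\<lambda>C D. dom_le D C)"

definition reading :: "nat set list \<Rightarrow> nat list" where
  "reading Cs = concat (map col Cs)"

lemma reading_simps [simp]: "reading [] = []" "reading (C # Cs) = col C @ reading Cs"
  by (simp_all add: reading_def)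

lemma tableau_Cons2: "dom_le D C \<Longrightarrow> tableau (D # Cs) \<Longrightarrow> tableau (C # D # Cs)"
  by (auto intro: dom_le_trans)

lemma plactic_lang_iff:
  "w \<in> plactic_lang n \<longleftrightarrow> (\<exists>Cs. set Cs \<subseteq> Pow {1..n} \<and> tableau Cs \<and> w = reading Cs)"
proof
  have tr: "transp (\<lambda>C D. dom_le D C)" by (auto intro: transpI dom_le_trans)
  have fin: "finite C" if "C \<subseteq> {1..n}" for C using that finite_subset by blast
  {
    assume "w \<in> plactic_lang n"
    then obtain \<alpha>s where \<alpha>s: "w = concat \<alpha>s" "\<forall>\<alpha>\<in>set \<alpha>s. column n \<alpha>"
      "\<forall>j. Suc j < length \<alpha>s \<longrightarrow> \<alpha>s ! j \<succeq> \<alpha>s ! Suc j" unfolding plactic_lang_def by blast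
    have col: "col (set \<alpha>) = \<alpha>" "set \<alpha> \<subseteq> {1..n}" if "\<alpha> \<in> set \<alpha>s" for \<alpha>
      using \<alpha>s(2) that col_eqI unfolding column_iff by blast+
    have "map col (map set \<alpha>s) = \<alpha>s" using col(1) by (simp add: map_idI)
    then have "w = reading (map set \<alpha>s)" using \<alpha>s(1) by (simp add: reading_def)
    moreover have "tableau (map set \<alpha>s)"
      unfolding sorted_wrt_iff_nth_Suc_transp[OF tr]
    proof (intro allI impI)
      fix j assume j: "Suc j < length (map set \<alpha>s)"
      then have "\<alpha>s ! j \<in> set \<alpha>s" "\<alpha>s ! Suc j \<in> set \<alpha>s" by simp_all
      then have "col (set (\<alpha>s ! j)) \<succeq> col (set (\<alpha>s ! Suc j))" using col(1) \<alpha>s(3) j by simp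
      then show "dom_le (map set \<alpha>s ! Suc j) (map set \<alpha>s ! j)"
        using j by (simp add: column_succeq_iff)
    qed
    moreover have "set (map set \<alpha>s) \<subseteq> Pow {1..n}" using col(2) by auto
    ultimately show "\<exists>Cs. set Cs \<subseteq> Pow {1..n} \<and> tableau Cs \<and> w = reading Cs" by blast
  next
    assume "\<exists>Cs. set Cs \<subseteq> Pow {1..n} \<and> tableau Cs \<and> w = reading Cs"
    then obtain Cs where Cs: "set Cs \<subseteq> Pow {1..n}" "tableau Cs" "w = reading Cs" by blast
    define Ds where "Ds = filter (\<lambda>C. C \<noteq> {}) Cs"
    have "concat (map col Ds) = w"
      unfolding Cs(3) Ds_def reading_def by (induction Cs) auto
    moreover have Ds: "tableau Ds" "\<forall>C\<in>set Ds. C \<subseteq> {1..n} \<and> C \<noteq> {}"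
      using Cs(1,2) unfolding Ds_def by (blast intro: sorted_wrt_filter, force)
    have "\<forall>\<alpha>\<in>set (map col Ds). column n \<alpha> \<and> \<alpha> \<noteq> []"
    proof
      fix \<alpha> assume "\<alpha> \<in> set (map col Ds)"
      then obtain C where C: "\<alpha> = col C" "C \<subseteq> {1..n}" "C \<noteq> {}" using Ds(2) by auto
      then have "set \<alpha> \<noteq> {}" using fin by simp
      then show "column n \<alpha> \<and> \<alpha> \<noteq> []" using C(1,2) column_eq_col by auto
    qed
    moreover have "\<forall>j. Suc j < length (map col Ds) \<longrightarrow> map col Ds ! j \<succeq> map col Ds ! Suc j"
    proof (intro allI impI)
      fix j assume j: "Suc j < length (map col Ds)"
      then have "Ds ! j \<in> set Ds" "Ds ! Suc j \<in> set Ds" by simp_all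
      then have "finite (Ds ! j)" "finite (Ds ! Suc j)" using Ds(2) fin by blast+
      moreover have "dom_le (Ds ! Suc j) (Ds ! j)"
        using Ds(1) j unfolding sorted_wrt_iff_nth_Suc_transp[OF tr] by simp
      ultimately show "map col Ds ! j \<succeq> map col Ds ! Suc j"
        using j by (simp add: column_succeq_iff)
    qed
    ultimately show "w \<in> plactic_lang n" unfolding plactic_lang_def by blast
  }
qed

text \<open>With no letter arriving, \<open>row_step\<close> leaves nothing unmatched:
  \<open>C\<close> expels the next column as a whole and takes its place.\<close>

lemma pass_reading:
  assumes "tableau (C # Cs)" "\<forall>D\<in>set (C # Cs). finite D"
  shows "pass (reading (C # Cs)) {} = (reading Cs, C)"
  using assms
proof (induction Cs arbitrary: C)
  case Nil
  then show ?case using pass_column_subset[of C "{}"] by simp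
next
  case (Cons D Cs)
  have DC: "dom_le D C" and fin: "finite C" "finite D" using Cons.prems by auto
  obtain E d where E: "pass (col C) (D \<union> set []) = (col E, C \<union> set d)"
      "length d \<le> length []" "E = D \<union> set [] - set d"
    by (rule row_step[OF fin DC, of "[]"]) auto
  have "pass (col C) D = (col D, C)" using E by simp
  moreover have "pass (reading (D # Cs)) {} = (reading Cs, D)" using Cons by simp
  ultimately show ?case by (simp add: pass_append[of "col C"])
qed

lemma tableau_emptyD:
  assumes "tableau ({} # Cs)" "\<forall>D\<in>set Cs. finite D"
  shows "reading Cs = []"
  using assms by (induction Cs) (auto dest: dom_le_emptyD)

lemma plactic_lang_unique:
  assumes "u \<in> plactic_lang n" "v \<in> plactic_lang n" "plactic_eq n u v"
  shows "u = v"
  using assms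
proof (induction u arbitrary: v rule: length_induct)
  case (1 u)
  have split: "\<exists>C w'. pass w {} = (w', C) \<and> w = col C @ w' \<and> w' \<in> plactic_lang n \<and>
      (C = {} \<longrightarrow> w' = []) \<and> finite C" if w: "w \<in> plactic_lang n" for w
  proof -
    obtain Cs where Cs: "set Cs \<subseteq> Pow {1..n}" "tableau Cs" "w = reading Cs"
      using w plactic_lang_iff by blast
    show ?thesis
    proof (cases Cs)
      case Nil
      then show ?thesis using Cs w by (intro exI[of _ "{}"]) auto
    next
      case (Cons C Ds)
      have fin: "\<forall>D\<in>set (C # Ds). finite D"
        using Cs(1) Cons finite_subset by (metis PowD finite_atLeastAtMost subsetD)
      have "pass w {} = (reading Ds, C)" using pass_reading[of C Ds] fin Cs Cons by simp
      moreover have "reading Ds \<in> plactic_lang n" unfolding plactic_lang_iff using Cs Cons by auto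
      moreover have "C = {} \<longrightarrow> reading Ds = []" using tableau_emptyD Cs(2) Cons fin by auto
      ultimately show ?thesis using Cs(3) Cons fin by auto
    qed
  qed
  obtain C u' where u: "pass u {} = (u', C)" "u = col C @ u'" "u' \<in> plactic_lang n"
    "C = {} \<longrightarrow> u' = []" "finite C" using split[OF "1.prems"(1)] by blast
  obtain D v' where v: "pass v {} = (v', D)" "v = col D @ v'" "v' \<in> plactic_lang n"
    "D = {} \<longrightarrow> v' = []" using split[OF "1.prems"(2)] by blast
  have "snd (pass u {}) = snd (pass v {}) \<and> plactic_eq n (fst (pass u {})) (fst (pass v {}))"
    using plactic_eq_pass[OF "1.prems"(3)] unfolding pass_equiv_def by blast
  then have CD: "C = D" and eq: "plactic_eq n u' v'" using u(1) v(1) by auto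
  show ?case
  proof (cases "C = {}")
    case True
    then show ?thesis using u(2,4) v(2,4) CD by simp
  next
    case False
    then have "length u' < length u" using u(2,5) by (simp add: card_gt_0_iff)
    then have "u' = v'" using 1 u(3) v(3) eq by blast
    then show ?thesis using u(2) v(2) CD by simp
  qed
qed

section \<open>Automata for multiplication by a letter\<close>

type_synonym column_state = "nat set \<times> nat list"

definition carries :: "nat \<Rightarrow> nat list set" where
  "carries n = {c. set c \<subseteq> {1..n} \<and> length c \<le> 1}"

text \<open>A state \<open>(A, c)\<close> consists of the column \<open>A\<close> of the first word read last and of a letter \<open>c\<close>,
  possibly absent, that crosses the boundary to the next column \<open>B\<close>: it leaves \<open>A\<close> in a
  column insertion (left multiplication) and enters \<open>A\<close> in a row insertion (right multiplication).
  \<open>E\<close> is the column of the second word that corresponds to \<open>B\<close>.\<close>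

definition transitions ::
  "nat \<Rightarrow> (nat set \<Rightarrow> nat list \<Rightarrow> nat set \<Rightarrow> nat list \<Rightarrow> nat set \<Rightarrow> bool) \<Rightarrow>
     (column_state \<times> nat list \<times> nat list \<times> column_state) set" where
  "transitions n R = {((A, c), col B, col E, (B, d)) | A c B d E.
     A \<subseteq> {1..n} \<and> B \<subseteq> {1..n} \<and> E \<subseteq> {1..n} \<and> c \<in> carries n \<and> d \<in> carries n \<and>
     dom_le E A \<and> dom_le B E \<and> R A c B d E}"

definition column_rule :: "nat set \<Rightarrow> nat list \<Rightarrow> nat set \<Rightarrow> nat list \<Rightarrow> nat set \<Rightarrow> bool" where
  "column_rule A c B d E \<longleftrightarrow> set c \<subseteq> A \<and> pass c B = (d, E)"

text \<open>Row insertion written as column insertion: \<open>A\<close> times \<open>B\<close>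
  enlarged by \<open>d\<close> is \<open>A\<close> enlarged by \<open>c\<close> times
  \<open>E\<close>. So \<open>pass\<close> and its soundness serve both multiplications.\<close>

definition row_rule :: "nat set \<Rightarrow> nat list \<Rightarrow> nat set \<Rightarrow> nat list \<Rightarrow> nat set \<Rightarrow> bool" where
  "row_rule A c B d E \<longleftrightarrow> set c \<inter> A = {} \<and> set d \<inter> B = {} \<and>
     pass (col A) (B \<union> set d) = (col E, A \<union> set c)"

lemma transitionsE:
  assumes "(q, x, y, q') \<in> transitions n R"
  obtains A c B d E where "q = (A, c)" "x = col B" "y = col E" "q' = (B, d)"
    "A \<subseteq> {1..n}" "B \<subseteq> {1..n}" "E \<subseteq> {1..n}" "finite A" "finite B" "finite E"
    "c \<in> carries n" "d \<in> carries n" "dom_le E A" "dom_le B E" "R A c B d E"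
proof -
  have "finite C" if "C \<subseteq> {1..n}" for C using that finite_subset by blast
  then show ?thesis using assms that unfolding transitions_def by blast
qed

lemma transitionsI:
  assumes "A \<subseteq> {1..n}" "B \<subseteq> {1..n}" "E \<subseteq> {1..n}" "c \<in> carries n" "d \<in> carries n"
    "dom_le E A" "dom_le B E" "R A c B d E"
  shows "((A, c), col B, col E, (B, d)) \<in> transitions n R"
  using assms unfolding transitions_def by blast

lemma finite_carries: "finite (carries n)"
  unfolding carries_def by (rule finite_lists_length_le) simp

lemma finite_transitions: "finite (transitions n R)"
proof -
  let ?P = "Pow {1..n}"
  have "transitions n R \<subseteq> (?P \<times> carries n) \<times> col ` ?P \<times> col ` ?P \<times> (?P \<times> carries n)"
    unfolding transitions_def by blast
  then show ?thesis by (rule finite_subset) (simp add: finite_carries)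
qed

lemma transitions_lists:
  assumes "(q, x, y, q') \<in> transitions n R"
  shows "x \<in> lists {1..n} \<and> y \<in> lists {1..n}"
  using assms by (rule transitionsE) (metis col_simps(1) in_lists_conv_set subsetD)

text \<open>One step gives \<open>dom_le B E\<close>, and the next gives \<open>dom_le E' B\<close>
  for the following new column \<open>E'\<close>; so conditions on single transitions make both
  tapes tableaux.\<close>

lemma path_plactic_lang:
  assumes "path (transitions n R) q u v q'"
  shows "\<exists>Cs Es. set Cs \<subseteq> Pow {1..n} \<and> set Es \<subseteq> Pow {1..n} \<and> tableau (fst q # Cs) \<and>
    tableau (fst q # Es) \<and> u = reading Cs \<and> v = reading Es"
  using assms
proof induction
  case (path_refl q)
  show ?case by (intro exI[of _ "[]"]) simp
next
  case (path_step q x y q' u v q'')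
  obtain A c B d E where T: "q = (A, c)" "x = col B" "y = col E" "q' = (B, d)"
    "B \<subseteq> {1..n}" "E \<subseteq> {1..n}" "dom_le E A" "dom_le B E"
    using path_step.hyps(1) by (rule transitionsE)
  obtain Cs Es where C: "set Cs \<subseteq> Pow {1..n}" "set Es \<subseteq> Pow {1..n}" "tableau (B # Cs)"
    "tableau (B # Es)" "u = reading Cs" "v = reading Es"
    using path_step.IH T(4) by auto
  have BA: "dom_le B A" using T(7,8) dom_le_trans by blast
  have "tableau (A # B # Cs)" using tableau_Cons2[OF BA C(3)] .
  moreover have "tableau (E # Es)" using tableau_Cons2[OF T(8) C(4)] by simp
  then have "tableau (A # E # Es)" by (rule tableau_Cons2[OF T(7)])
  ultimately show ?case
    using T C by (intro exI[of _ "B # Cs"] exI[of _ "E # Es"]) simp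
qed

lemma path_in_plactic_lang:
  assumes "path (transitions n R) q u v q'"
  shows "u \<in> plactic_lang n \<and> v \<in> plactic_lang n"
proof -
  obtain Cs Es where "set Cs \<subseteq> Pow {1..n}" "set Es \<subseteq> Pow {1..n}" "tableau (fst q # Cs)"
    "tableau (fst q # Es)" "u = reading Cs" "v = reading Es"
    using path_plactic_lang[OF assms] by blast
  then show ?thesis unfolding plactic_lang_iff by auto
qed

section \<open>Soundness of the two automata\<close>

lemma column_path_plactic_eq:
  assumes "path (transitions n column_rule) q u v q'" "snd q \<in> carries n"
  shows "plactic_eq n (snd q @ u) (v @ snd q')"
  using assms
proof induction
  case (path_refl q)
  then have "snd q \<in> lists {1..n}" unfolding carries_def in_lists_conv_set by blast
  from presented_cong.refl[OF this] show ?case by simp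
next
  case (path_step q x y q' u v q'')
  obtain A c B d E where T: "q = (A, c)" "x = col B" "y = col E" "q' = (B, d)" "B \<subseteq> {1..n}"
    "c \<in> carries n" "d \<in> carries n" "column_rule A c B d E"
    using path_step.hyps(1) by (rule transitionsE)
  have *: "plactic_eq n (c @ col B) (col E @ d)"
    using pass_plactic_eq[of B n c d E] T(5,6,8) by (simp add: column_rule_def carries_def)
  have IH: "plactic_eq n (d @ u) (v @ snd q'')" using path_step.IH T(4,7) by simp
  have "u \<in> lists {1..n}" using plactic_eq_lists[OF IH] by simp
  then have 1: "plactic_eq n (c @ col B @ u) (col E @ d @ u)"
    using plactic_context[OF *, of "[]" u] by simp
  have "col E \<in> lists {1..n}" using transitions_lists[OF path_step.hyps(1)] T(3) by blast
  then have 2: "plactic_eq n (col E @ d @ u) (col E @ v @ snd q'')"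
    using plactic_context[OF IH, of "col E" "[]"] by simp
  show ?case using presented_cong.trans[OF 1 2] T(1-3) by simp
qed

text \<open>\<open>fst q\<close> enlarged by \<open>snd q\<close> is an intermediate column, into
  which the preceding column is still to be inserted. The induction starts at the right end, where
  the multiplying letter enters the empty column.\<close>

lemma row_path_plactic_eq:
  assumes "path (transitions n row_rule) q u v q'" "fst q' = {}" "snd q' \<in> carries n"
    "fst q \<subseteq> {1..n}"
  shows "plactic_eq n (col (fst q) @ u @ snd q') (col (fst q \<union> set (snd q)) @ v)"
  using assms
proof induction
  case (path_refl q)
  then have "snd q \<in> lists {1..n}" unfolding carries_def in_lists_conv_set by blast
  moreover have "col (set (snd q)) = snd q"
    using path_refl(2) by (intro col_eqI) (cases "snd q"; auto simp: carries_def)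
  ultimately show ?case using path_refl(1) presented_cong.refl[of "snd q"] by simp
next
  case (path_step q x y q' u v q'')
  obtain A c B d E where T: "q = (A, c)" "x = col B" "y = col E" "q' = (B, d)" "A \<subseteq> {1..n}"
    "B \<subseteq> {1..n}" "d \<in> carries n" "row_rule A c B d E" "finite A"
    using path_step.hyps(1) by (rule transitionsE)
  have IH: "plactic_eq n (col B @ u @ snd q'') (col (B \<union> set d) @ v)"
    using path_step.IH path_step.prems T(4,6) by simp
  have colA: "set (col A) \<subseteq> {1..n}" using T(5,9) by simp
  then have "col A \<in> lists {1..n}" unfolding in_lists_conv_set by blast
  then have 1: "plactic_eq n (col A @ col B @ u @ snd q'') (col A @ col (B \<union> set d) @ v)"
    using plactic_context[OF IH, of "col A" "[]"] by simp
  have "B \<union> set d \<subseteq> {1..n}" using T(6,7) by (simp add: carries_def)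
  from pass_plactic_eq[OF this colA] T(8)
  have *: "plactic_eq n (col A @ col (B \<union> set d)) (col (A \<union> set c) @ col E)"
    by (simp add: row_rule_def)
  have "v \<in> lists {1..n}" using plactic_eq_lists[OF IH] by simp
  then have 2: "plactic_eq n (col A @ col (B \<union> set d) @ v) (col (A \<union> set c) @ col E @ v)"
    using plactic_context[OF *, of "[]" v] by simp
  show ?case using presented_cong.trans[OF 1 2] T(1-3) by simp
qed

section \<open>Totality of the two automata\<close>

lemma column_path_total:
  assumes "tableau (A # Cs)" "set (A # Cs) \<subseteq> Pow {1..n}" "c \<in> carries n" "set c \<subseteq> A"
  shows "\<exists>v. path (transitions n column_rule) (A, c) (reading Cs) v ({}, [])"
  using assms
proof (induction Cs arbitrary: A c)
  case Nil
  have "c = [] \<or> (\<exists>x. c = [x])" using Nil.prems(3) by (cases c) (auto simp: carries_def)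
  then have "pass c {} = ([], set c)" by (auto simp: bump_def)
  moreover have "finite A" using Nil.prems(2) finite_subset by auto
  \<comment> \<open>Beyond the last column an empty one is read: a carried letter becomes a new
    column, and without one the step still leads to the final state.\<close>
  ultimately have "((A, c), col {}, col (set c), ({}, [])) \<in> transitions n column_rule"
    using Nil.prems dom_le_subset[of A "set c"]
    by (intro transitionsI) (auto simp: column_rule_def carries_def)
  from path_single[OF this] show ?case by auto
next
  case (Cons B Cs)
  obtain d E where dE: "pass c B = (d, E)" by fastforce
  have AB: "A \<subseteq> {1..n}" "B \<subseteq> {1..n}" "dom_le B A" and c: "length c \<le> 1" "set c \<subseteq> {1..n}"
    using Cons.prems by (simp_all add: carries_def)
  have fin: "finite A" "finite B" using AB finite_subset by blast+
  note step = column_step[OF dE c(1) Cons.prems(4) fin AB(3)]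
  have "c \<in> lists {1..n}" using c(2) unfolding in_lists_conv_set by blast
  then have "E \<subseteq> {1..n}" using pass_lists[OF _ AB(2) dE] by blast
  have d: "d \<in> carries n" using step(3,4) AB(2) by (auto simp: carries_def)
  have "((A, c), col B, col E, (B, d)) \<in> transitions n column_rule"
    using AB \<open>E \<subseteq> {1..n}\<close> Cons.prems(3,4) d step(1,2) dE
    by (intro transitionsI) (simp_all add: column_rule_def)
  moreover obtain v where "path (transitions n column_rule) (B, d) (reading Cs) v ({}, [])"
    using Cons.IH[of B d] Cons.prems d step(3) by auto
  ultimately show ?case using path_step by fastforce
qed

text \<open>The letter travels against the reading direction, so the run is built from its end and
  yields the letter \<open>c\<close> with which it has to start.\<close>

lemma row_path_total:
  assumes "tableau (A # Cs)" "set (A # Cs) \<subseteq> Pow {1..n}" "e \<in> carries n"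
  shows "\<exists>c v. path (transitions n row_rule) (A, c) (reading Cs) v ({}, e) \<and>
    c \<in> carries n \<and> set c \<inter> A = {}"
  using assms
proof (induction Cs arbitrary: A)
  have step: "\<exists>c E. ((A, c), col B, col E, (B, d)) \<in> transitions n row_rule \<and>
      c \<in> carries n \<and> set c \<inter> A = {}"
    if AB: "A \<subseteq> {1..n}" "B \<subseteq> {1..n}" "dom_le B A" and d: "d \<in> carries n" "set d \<inter> B = {}" for A B d
  proof -
    have fin: "finite A" "finite B" using AB finite_subset by blast+
    obtain E c where c: "pass (col A) (B \<union> set d) = (col E, A \<union> set c)" "set c \<inter> A = {}"
      "length c \<le> length d" "set c \<subseteq> B \<union> set d" "E = B \<union> set d - set c" "dom_le E A" "dom_le B E"
      using row_step[OF fin AB(3) d(2)] .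
    have "c \<in> carries n" "E \<subseteq> {1..n}" using c(3-5) AB d(1) by (auto simp: carries_def)
    then show ?thesis
      using c AB d by (intro exI[of _ c] exI[of _ E] conjI transitionsI) (auto simp: row_rule_def)
  qed
  {
    case Nil
    then obtain c E where c: "((A, c), col {}, col E, ({}, e)) \<in> transitions n row_rule"
      "c \<in> carries n" "set c \<inter> A = {}" using step[of A "{}" e] by auto
    from path_single[OF c(1)] c(2,3) show ?case by auto
  next
    case (Cons B Cs)
    have "\<exists>d v. path (transitions n row_rule) (B, d) (reading Cs) v ({}, e) \<and>
        d \<in> carries n \<and> set d \<inter> B = {}"
      using Cons.prems by (intro Cons.IH) simp_all
    then obtain d v where d: "path (transitions n row_rule) (B, d) (reading Cs) v ({}, e)"
      "d \<in> carries n" "set d \<inter> B = {}" by blast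
    obtain c E where c: "((A, c), col B, col E, (B, d)) \<in> transitions n row_rule"
      "c \<in> carries n" "set c \<inter> A = {}" using step[of A B d] Cons.prems d by auto
    from path_step[OF c(1) d(1)] c(2,3) show ?case by auto
  }
qed

text \<open>A letter multiplied from the left can be regarded as coming out of the full column; in
  the row rule no letter can enter it.\<close>

lemma tableau_full_column:
  assumes "w \<in> plactic_lang n"
  obtains Cs where "tableau ({1..n} # Cs)" "set ({1..n} # Cs) \<subseteq> Pow {1..n}" "w = reading Cs"
proof -
  obtain Cs where Cs: "set Cs \<subseteq> Pow {1..n}" "tableau Cs" "w = reading Cs"
    using assms plactic_lang_iff by blast
  have "\<forall>C\<in>set Cs. dom_le C {1..n}"
    using Cs(1) by (intro ballI dom_le_subset) auto
  then have "tableau ({1..n} # Cs)" using Cs(2) by simp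
  from that[OF this _ Cs(3)] Cs(1) show ?thesis by simp
qed

text \<open>Totality of the automata suffices for completeness, because the second word is determined by
  the element it represents.\<close>

lemma column_path_iff:
  assumes c: "c \<in> carries n"
  shows "path (transitions n column_rule) ({1..n}, c) u v ({}, []) \<longleftrightarrow>
    u \<in> plactic_lang n \<and> v \<in> plactic_lang n \<and> plactic_eq n (c @ u) v"
proof
  assume path: "path (transitions n column_rule) ({1..n}, c) u v ({}, [])"
  then show "u \<in> plactic_lang n \<and> v \<in> plactic_lang n \<and> plactic_eq n (c @ u) v"
    using path_in_plactic_lang[OF path] column_path_plactic_eq[OF path] c by simp
next
  assume uv: "u \<in> plactic_lang n \<and> v \<in> plactic_lang n \<and> plactic_eq n (c @ u) v"
  then obtain Cs where Cs: "tableau ({1..n} # Cs)" "set ({1..n} # Cs) \<subseteq> Pow {1..n}" "u = reading Cs"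
    using tableau_full_column by blast
  have "set c \<subseteq> {1..n}" using c by (simp add: carries_def)
  then obtain v' where v': "path (transitions n column_rule) ({1..n}, c) u v' ({}, [])"
    using column_path_total[OF Cs(1,2) c] Cs(3) by blast
  have "plactic_eq n (c @ u) v'" using column_path_plactic_eq[OF v'] c by simp
  then have "plactic_eq n v v'" using uv presented_cong.sym presented_cong.trans by metis
  then have "v = v'" using plactic_lang_unique uv path_in_plactic_lang[OF v'] by blast
  then show "path (transitions n column_rule) ({1..n}, c) u v ({}, [])" using v' by simp
qed

text \<open>Applied at the start, \<open>row_path_plactic_eq\<close> would leave a factor
  \<open>col {1..n}\<close> on both sides. It is applied after the first step, where inserting the
  full column expels all of \<open>B\<close> and \<open>d\<close>, so that \<open>E\<close> is their
  union.\<close>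

lemma row_path_start_plactic_eq:
  assumes "path (transitions n row_rule) ({1..n}, []) u v ({}, e)" "e \<in> carries n" "n \<ge> 1"
  shows "plactic_eq n (u @ e) v"
  using assms(1)
proof (cases rule: path.cases)
  case path_refl
  \<comment> \<open>An empty run would need \<open>{1..n}\<close> to be empty.\<close>
  then show ?thesis using assms(3) by simp
next
  case (path_step x y q' u' v')
  obtain A c B d E where T: "x = col B" "y = col E" "q' = (B, d)" "B \<subseteq> {1..n}" "E \<subseteq> {1..n}"
    "d \<in> carries n" "row_rule A c B d E" "({1..n}, []) = (A, c)"
    using path_step(3) by (rule transitionsE)
  have Bd: "B \<union> set d \<subseteq> {1..n}" using T(4,6) by (simp add: carries_def)
  then have "col E = col (B \<union> set d)"
    using pass_column_subset[OF _ Bd] T(7,8) by (auto simp: row_rule_def)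
  moreover have "plactic_eq n (col B @ u' @ e) (col (B \<union> set d) @ v')"
    using row_path_plactic_eq[OF path_step(4)] T(3,4) assms(2) by simp
  ultimately show ?thesis using path_step(1,2) T(1,2) by simp
qed

lemma row_path_iff:
  assumes e: "e \<in> carries n" and n: "n \<ge> 1"
  shows "path (transitions n row_rule) ({1..n}, []) u v ({}, e) \<longleftrightarrow>
    u \<in> plactic_lang n \<and> v \<in> plactic_lang n \<and> plactic_eq n (u @ e) v"
proof
  assume path: "path (transitions n row_rule) ({1..n}, []) u v ({}, e)"
  then show "u \<in> plactic_lang n \<and> v \<in> plactic_lang n \<and> plactic_eq n (u @ e) v"
    using path_in_plactic_lang[OF path] row_path_start_plactic_eq[OF path e n] by simp
next
  assume uv: "u \<in> plactic_lang n \<and> v \<in> plactic_lang n \<and> plactic_eq n (u @ e) v"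
  then obtain Cs where Cs: "tableau ({1..n} # Cs)" "set ({1..n} # Cs) \<subseteq> Pow {1..n}" "u = reading Cs"
    using tableau_full_column by blast
  from row_path_total[OF Cs(1,2) e, folded Cs(3)]
  obtain c v' where c: "path (transitions n row_rule) ({1..n}, c) u v' ({}, e)"
    "c \<in> carries n" "set c \<inter> {1..n} = {}" by (elim exE conjE)
  from c(2) have "set c \<subseteq> {1..n}" unfolding carries_def by blast
  with c(3) have "set c = {}" by (simp add: Int_absorb2)
  with c(1) have v': "path (transitions n row_rule) ({1..n}, []) u v' ({}, e)" by simp
  have "plactic_eq n (u @ e) v'" using row_path_start_plactic_eq[OF v' e n] .
  then have "plactic_eq n v v'" using uv presented_cong.sym presented_cong.trans by metis
  then have "v = v'" using plactic_lang_unique uv path_in_plactic_lang[OF v'] by blast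
  then show "path (transitions n row_rule) ({1..n}, []) u v ({}, e)" using v' by simp
qed

section \<open>Regularity of the relations and of the language\<close>

lemma regular_column:
  assumes "c \<in> carries n"
  defines "S \<equiv> {(u, v). u \<in> plactic_lang n \<and> v \<in> plactic_lang n \<and> plactic_eq n (c @ u) v}"
  shows "regular_language (padded_alphabet {1..n}) (delta_R ` S)"
    and "regular_language (padded_alphabet {1..n}) (delta_L ` S)"
proof -
  have S: "S = {(u, v). path (transitions n column_rule) ({1..n}, c) u v ({}, [])}"
    unfolding S_def column_path_iff[OF assms(1)] ..
  \<comment> \<open>The sign is negative because a letter in transit is still owed to the second
    tape.\<close>
  have f: "int (length x) + - int (length (snd q')) = int (length y) + - int (length (snd q))"
    if "(q, x, y, q') \<in> transitions n column_rule" for q x y q'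
    using that
  proof (rule transitionsE)
    fix A c B d E
    assume "q = (A, c)" "x = col B" "y = col E" "q' = (B, d)" "finite B" "finite E" "column_rule A c B d E"
    then show ?thesis using pass_card[of B c d E] by (simp add: column_rule_def)
  qed
  note reg = regular_delta_path[of "{1..n}", OF _ finite_transitions transitions_lists f]
  show "regular_language (padded_alphabet {1..n}) (delta_R ` S)"
    and "regular_language (padded_alphabet {1..n}) (delta_L ` S)"
    unfolding S by (rule reg; simp)+
qed

lemma regular_row:
  assumes "e \<in> carries n" "n \<ge> 1"
  defines "S \<equiv> {(u, v). u \<in> plactic_lang n \<and> v \<in> plactic_lang n \<and> plactic_eq n (u @ e) v}"
  shows "regular_language (padded_alphabet {1..n}) (delta_R ` S)"
    and "regular_language (padded_alphabet {1..n}) (delta_L ` S)"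
proof -
  have S: "S = {(u, v). path (transitions n row_rule) ({1..n}, []) u v ({}, e)}"
    unfolding S_def row_path_iff[OF assms(1,2)] ..
  \<comment> \<open>The sign is positive because the second tape already accounts for the letter
    \<open>d\<close> that comes from further right.\<close>
  have f: "int (length x) + int (length (snd q')) = int (length y) + int (length (snd q))"
    if "(q, x, y, q') \<in> transitions n row_rule" for q x y q'
    using that
  proof (rule transitionsE)
    fix A c B d E
    assume *: "q = (A, c)" "x = col B" "y = col E" "q' = (B, d)" "finite A" "finite B" "finite E"
      "c \<in> carries n" "d \<in> carries n" "row_rule A c B d E"
    have len: "card (set z) = length z" if "z \<in> carries n" for z
      using that by (cases z) (auto simp: carries_def)
    have "card (A \<union> set c) = card A + length c" "card (B \<union> set d) = card B + length d"
      using * len by (auto simp: row_rule_def card_Un_disjoint Int_commute)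
    then show ?thesis
      using pass_card[of "B \<union> set d" "col A" "col E" "A \<union> set c"] * by (simp add: row_rule_def)
  qed
  note reg = regular_delta_path[of "{1..n}", OF _ finite_transitions transitions_lists f]
  show "regular_language (padded_alphabet {1..n}) (delta_R ` S)"
    and "regular_language (padded_alphabet {1..n}) (delta_L ` S)"
    unfolding S by (rule reg; simp)+
qed

lemma plactic_lang_lists: "plactic_lang n \<subseteq> lists {1..n}"
  unfolding plactic_lang_def column_def by fastforce

text \<open>By uniqueness the relation for the empty word is the diagonal of the language, which is
  thus the preimage of a regular language under \<open>a \<mapsto> (Some a, Some a)\<close>.\<close>

lemma regular_plactic_lang: "regular_language {1..n} (plactic_lang n)"
proof -
  let ?h = "\<lambda>a::nat. (Some a, Some a)"
  define S where "S = {(u, v). u \<in> plactic_lang n \<and> v \<in> plactic_lang n \<and> plactic_eq n ([] @ u) v}"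
  have S: "(u, v) \<in> S \<longleftrightarrow> u = v \<and> u \<in> plactic_lang n" for u v
  proof -
    have "plactic_eq n u u" if "u \<in> plactic_lang n"
      using that plactic_lang_lists by (blast intro: presented_cong.refl)
    then show ?thesis unfolding S_def using plactic_lang_unique[of u n v] by auto
  qed
  have diag: "delta_R (u, u) = map ?h u" for u :: "nat list"
    by (simp add: delta_R_def pad_right_def zip_map_map zip_same_conv_map)
  have inj: "map ?h u = map ?h v \<longleftrightarrow> u = v" for u v
    by (rule inj_map_eq_map) (simp add: inj_def)
  have "plactic_lang n = {w \<in> lists {1..n}. map ?h w \<in> delta_R ` S}"
  proof (intro equalityI subsetI)
    fix w assume w: "w \<in> plactic_lang n"
    then have "map ?h w \<in> delta_R ` S" using S[of w w] diag[of w] by (metis image_eqI)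
    then show "w \<in> {w \<in> lists {1..n}. map ?h w \<in> delta_R ` S}" using plactic_lang_lists w by blast
  next
    fix w assume "w \<in> {w \<in> lists {1..n}. map ?h w \<in> delta_R ` S}"
    then obtain u v where "map ?h w = delta_R (u, v)" "(u, v) \<in> S" by auto
    then show "w \<in> plactic_lang n" using S diag inj by metis
  qed
  moreover have "regular_language (padded_alphabet {1..n}) (delta_R ` S)"
    unfolding S_def by (rule regular_column) (simp add: carries_def)
  ultimately show ?thesis
    using regular_language_vimage[of "padded_alphabet {1..n}" "delta_R ` S" "{1..n}" ?h]
    by (auto simp: padded_alphabet_def)
qed

text \<open>Letters are multiplied from the left one at a time, and each product is the second tape
  of a run of the column automaton.\<close>

lemma plactic_lang_surj:
  assumes "w \<in> lists {1..n}"
  shows "\<exists>v\<in>plactic_lang n. plactic_eq n w v"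
  using assms
proof (induction w)
  case Nil
  have "[] \<in> plactic_lang n" unfolding plactic_lang_iff by (rule exI[of _ "[]"]) simp
  moreover have "plactic_eq n [] []" by (rule presented_cong.refl) simp
  ultimately show ?case by blast
next
  case (Cons a w)
  then obtain u where u: "u \<in> plactic_lang n" "plactic_eq n w u" by blast
  obtain Cs where Cs: "tableau ({1..n} # Cs)" "set ({1..n} # Cs) \<subseteq> Pow {1..n}" "u = reading Cs"
    using u(1) tableau_full_column by blast
  have a: "[a] \<in> carries n" "set [a] \<subseteq> {1..n}" using Cons.hyps by (simp_all add: carries_def)
  obtain v where "path (transitions n column_rule) ({1..n}, [a]) u v ({}, [])"
    using column_path_total[OF Cs(1,2) a] Cs(3) by blast
  then have v: "v \<in> plactic_lang n" "plactic_eq n ([a] @ u) v" using column_path_iff a(1) by blast+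
  have "plactic_eq n ([a] @ w) ([a] @ u)"
    using plactic_context[OF u(2), of "[a]" "[]"] Cons.hyps by simp
  from presented_cong.trans[OF this v(2)] show ?case using v(1) by auto
qed

theorem theorem4p4:
  fixes n :: nat
  assumes "n \<ge> 1"
  shows "biautomatic_structure (plactic_monoid n) (plactic_gen n) {1..n} (plactic_lang n)"
proof -
  let ?X = "{1..n}" and ?R = "plactic_rels n" and ?L = "plactic_lang n"
  note R = plactic_rels_subset[of n]
  have wv: "word_value (plactic_monoid n) (plactic_gen n) w = presented_class ?X ?R w"
    if "w \<in> lists ?X" for w
    using presented_monoid_word_value[OF R that] by (simp add: plactic_monoid_def plactic_gen_def[abs_def])
  have carrier: "carrier (plactic_monoid n) = presented_class ?X ?R ` lists ?X"
    unfolding plactic_monoid_def by (rule presented_monoid_carrier)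
  have eq: "word_value (plactic_monoid n) (plactic_gen n) u = word_value (plactic_monoid n) (plactic_gen n) v
      \<longleftrightarrow> plactic_eq n u v" if "u \<in> lists ?X" "v \<in> lists ?X" for u v
    using wv presented_class_eq_iff[OF R] that by simp
  have lists: "u \<in> lists ?X" if "u \<in> ?L" for u using that plactic_lang_lists by blast
  have carry: "a \<in> carries n \<and> a \<in> lists ?X" if "a \<in> insert [] ((\<lambda>x. [x]) ` ?X)" for a
    using that by (auto simp: carries_def)
  have right: "right_rel (plactic_monoid n) (plactic_gen n) ?L a =
      {(u, v). u \<in> ?L \<and> v \<in> ?L \<and> plactic_eq n (u @ a) v}" if a: "a \<in> lists ?X" for a
    unfolding right_rel_def
  proof (intro Collect_cong prod.case_cong HOL.refl)
    show "(u \<in> ?L \<and> v \<in> ?L \<and> word_value (plactic_monoid n) (plactic_gen n) (u @ a) =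
        word_value (plactic_monoid n) (plactic_gen n) v) \<longleftrightarrow>
      (u \<in> ?L \<and> v \<in> ?L \<and> plactic_eq n (u @ a) v)" for u v
      using eq[of "u @ a" v] lists[of u] lists[of v] a by auto
  qed
  have left: "left_rel (plactic_monoid n) (plactic_gen n) ?L a =
      {(u, v). u \<in> ?L \<and> v \<in> ?L \<and> plactic_eq n (a @ u) v}" if a: "a \<in> lists ?X" for a
    unfolding left_rel_def
  proof (intro Collect_cong prod.case_cong HOL.refl)
    show "(u \<in> ?L \<and> v \<in> ?L \<and> word_value (plactic_monoid n) (plactic_gen n) (a @ u) =
        word_value (plactic_monoid n) (plactic_gen n) v) \<longleftrightarrow>
      (u \<in> ?L \<and> v \<in> ?L \<and> plactic_eq n (a @ u) v)" for u v
      using eq[of "a @ u" v] lists[of u] lists[of v] a by auto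
  qed
  show ?thesis
    unfolding biautomatic_structure_def
  proof (intro conjI ballI)
    show "monoid (plactic_monoid n)"
      unfolding plactic_monoid_def by (rule presented_monoid_monoid[OF R])
    show "plactic_gen n ` ?X \<subseteq> carrier (plactic_monoid n)"
      unfolding carrier plactic_gen_def by (intro image_subsetI imageI) simp
    show "word_value (plactic_monoid n) (plactic_gen n) ` lists ?X = carrier (plactic_monoid n)"
      unfolding carrier using wv by (intro image_cong HOL.refl)
    show "\<exists>w\<in>?L. word_value (plactic_monoid n) (plactic_gen n) w = m"
      if m: "m \<in> carrier (plactic_monoid n)" for m
    proof -
      obtain w where w: "w \<in> lists ?X" "m = presented_class ?X ?R w" using m carrier by blast
      then obtain v where "v \<in> ?L" "plactic_eq n w v" using plactic_lang_surj by blast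
      then show ?thesis using eq[OF w(1) lists] wv w by metis
    qed
    fix a assume "a \<in> insert [] ((\<lambda>x. [x]) ` ?X)"
    then have a: "a \<in> carries n" "a \<in> lists ?X" using carry by blast+
    show "regular_language (padded_alphabet ?X) (delta_R ` right_rel (plactic_monoid n) (plactic_gen n) ?L a)"
      "regular_language (padded_alphabet ?X) (delta_L ` right_rel (plactic_monoid n) (plactic_gen n) ?L a)"
      unfolding right[OF a(2)] by (rule regular_row[OF a(1) assms])+
    show "regular_language (padded_alphabet ?X) (delta_R ` left_rel (plactic_monoid n) (plactic_gen n) ?L a)"
      "regular_language (padded_alphabet ?X) (delta_L ` left_rel (plactic_monoid n) (plactic_gen n) ?L a)"
      unfolding left[OF a(2)] by (rule regular_column[OF a(1)])+
  qed (fact plactic_lang_lists regular_plactic_lang finite_atLeastAtMost)+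
qed

end
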